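(* Let $m,n,\ell$ be integers with $2\le m\le n\le \ell$ and $(m-1)(n-1)+1\le \ell\le mn$. Then every typical rank of real $m\times n\times \ell$ tensors lies in $\{\ell,\ell+1\}$, and $\ell$ is a typical rank.
   Context: A tensor $T=(t_{i,j,k})\in\mathbb R^{m\times n\times \ell}$ is called a Gaussian tensor if its entries are i.i.d. standard Gaussian. The rank of $T$ is the minimal $r$ such that $T=\sum_{i=1}^r a_i\otimes b_i\otimes c_i$ with $a_i\in\mathbb R^m,b_i\in\mathbb R^n,c_i\in\mathbb R^\ell$. An integer $r>0$ is a typical rank for the format $m\times n\times\ell$ if $\Pr\{\mathrm{rank}(T)=r\}>0$ for a Gaussian tensor $T\in\mathbb R^{m\times n\times\ell}$. *)

theory Defs
  imports "HOL-Probability.Probability"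
begin

text \<open>Real m x n x l tensors are functions on index triples (i,j,k) with i<m, j<n, k<l
  (0-based). Entries outside the index box are irrelevant.\<close>

definition tensor_index :: "nat \<Rightarrow> nat \<Rightarrow> nat \<Rightarrow> (nat \<times> nat \<times> nat) set" where
  "tensor_index m n l = {..<m} \<times> {..<n} \<times> {..<l}"

definition tensor_rank :: "nat \<Rightarrow> nat \<Rightarrow> nat \<Rightarrow> (nat \<times> nat \<times> nat \<Rightarrow> real) \<Rightarrow> nat" where
  "tensor_rank m n l T = (LEAST r. \<exists>a b c :: nat \<Rightarrow> nat \<Rightarrow> real.
      \<forall>i<m. \<forall>j<n. \<forall>k<l. T (i, j, k) = (\<Sum>s<r. a s i * b s j * c s k))"

definition gaussian_tensor :: "nat \<Rightarrow> nat \<Rightarrow> nat \<Rightarrow> (nat \<times> nat \<times> nat \<Rightarrow> real) measure" where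
  "gaussian_tensor m n l =
     PiM (tensor_index m n l) (\<lambda>_. density lborel (\<lambda>x. ennreal (std_normal_density x)))"

definition typical_rank :: "nat \<Rightarrow> nat \<Rightarrow> nat \<Rightarrow> nat \<Rightarrow> bool" where
  "typical_rank m n l r \<longleftrightarrow> r > 0 \<and>
     measure (gaussian_tensor m n l)
       {T \<in> space (gaussian_tensor m n l). tensor_rank m n l T = r} > 0"

end

theory Submission
  imports
    Defs
    "HOL-Computational_Algebra.Polynomial"
    "HOL-Library.Function_Algebras"
    "Jordan_Normal_Form.Determinant"
begin

text \<open>The rank is at least \<open>l\<close> almost surely because the \<open>l\<close> slices are almost surely independent.

  Let \<open>K = (m - 1) * (n - 1)\<close>, suppose \<open>l = K + 1\<close>, and let \<open>E\<close> be the matrix whose only nonzero entry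
  is a \<open>1\<close> in the corner \<open>(0, 0)\<close>. Near \<open>E\<close> the rank-one matrices in the span of \<open>E\<close> and the slices form
  a curve through \<open>E\<close>, obtained by Picard iteration. Its Taylor coefficients are polynomial in the
  tensor, so that the curve spans the whole space for almost every tensor as soon as it does so for
  one; an example is a tensor for which the curve is a rational normal curve. Hence the slices lie
  in a space of dimension \<open>l + 1\<close> spanned by rank-one matrices. The span of the slices alone is a
  hyperplane in this space. For the example its intersection with the curve can be prescribed to
  consist of \<open>l\<close> simple points; by the intermediate value theorem they survive in a neighbourhood of
  the example, where the rank is therefore at most \<open>l\<close>.

  For larger \<open>l\<close> the same argument applies to each subtensor made of a fixed set of \<open>K\<close> slices and
  one further slice.\<close>

section \<open>Polynomial functions under the Gaussian measure\<close>

text \<open>A matrix \<open>x\<close> with \<open>x 0 0\<close> nonzero has rank one as soon as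
  \<open>x i j * x 0 0 = x i 0 * x 0 j\<close> for all \<open>i, j\<close> \<ge> 1. These are
  \<open>K\<close> equations for the \<open>K + 1\<close> coefficients of the slices, which is why a
  curve of solutions is to be expected. Adding a multiple of \<open>E\<close> changes only
  \<open>x 0 0\<close>, which can therefore be given a fixed nonzero value; what remains is bilinear
  and is solved for the other \<open>K\<close> coordinates by a contraction. That the coefficient of
  \<open>E\<close> vanishes is one more equation, and it cuts out the hyperplane. All subtensors
  share the same \<open>E\<close>, so it costs a single dimension for every \<open>l\<close>.
  Spanning is always proved in dual form: a linear form vanishing on the curve, or on the chosen
  points of it, is zero. Rank \<open>l\<close> cannot be had for almost all tensors in this way,
  because the hyperplane must meet the curve in enough real points; this is only an open condition,
  whence the neighbourhood of an example.\<close>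

inductive_set polyfun :: "'i set \<Rightarrow> (('i \<Rightarrow> real) \<Rightarrow> real) set" for I where
  const: "(\<lambda>_. c) \<in> polyfun I"
| coord: "i \<in> I \<Longrightarrow> (\<lambda>x. x i) \<in> polyfun I"
| add: "f \<in> polyfun I \<Longrightarrow> g \<in> polyfun I \<Longrightarrow> (\<lambda>x. f x + g x) \<in> polyfun I"
| mult: "f \<in> polyfun I \<Longrightarrow> g \<in> polyfun I \<Longrightarrow> (\<lambda>x. f x * g x) \<in> polyfun I"

lemma polyfun_sum:
  assumes "\<And>a. a \<in> A \<Longrightarrow> f a \<in> polyfun I"
  shows "(\<lambda>x. \<Sum>a\<in>A. f a x) \<in> polyfun I"
  using assms by (induction A rule: infinite_finite_induct) (auto intro: polyfun.intros)

lemma polyfun_prod: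
  assumes "\<And>a. a \<in> A \<Longrightarrow> f a \<in> polyfun I"
  shows "(\<lambda>x. \<Prod>a\<in>A. f a x) \<in> polyfun I"
  using assms by (induction A rule: infinite_finite_induct) (auto intro: polyfun.intros)

lemma polyfun_continuous:
  assumes "f \<in> polyfun I" "0 < e"
  shows "\<exists>d>0. \<forall>x. (\<forall>i\<in>I. \<bar>x i - y i\<bar> < d) \<longrightarrow> \<bar>f x - f y\<bar> < e"
proof -
  \<comment> \<open>The neighbourhood filter of \<open>y\<close> that sees only the coordinates in
    \<open>I\<close>. With \<open>ev\<close>, the limit rules for sums and products replace
    epsilon-delta estimates.\<close>
  define F where "F = (INF d\<in>{0<..}. principal {x. \<forall>i\<in>I. \<bar>x i - y i\<bar> < d})"
  have ev: "eventually P F \<longleftrightarrow> (\<exists>d>0. \<forall>x. (\<forall>i\<in>I. \<bar>x i - y i\<bar> < d) \<longrightarrow> P x)" for P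
    unfolding F_def
  proof (subst eventually_INF_base, goal_cases)
    case (2 a b)
    then show ?case by (intro bexI[of _ "min a b"]) auto
  qed (auto simp: eventually_principal)
  have "(f \<longlongrightarrow> f y) F"
    using assms(1)
  proof induction
    case (coord i)
    show ?case unfolding tendsto_iff ev dist_real_def using coord by auto
  qed (auto intro: tendsto_const tendsto_add tendsto_mult)
  then show ?thesis using assms(2) unfolding tendsto_iff ev dist_real_def by auto
qed

lemma polyfun_continuous_finite:
  assumes "finite F" "F \<subseteq> polyfun I" "0 < e"
  shows "\<exists>d>0. \<forall>x. (\<forall>i\<in>I. \<bar>x i - y i\<bar> < d) \<longrightarrow> (\<forall>f\<in>F. \<bar>f x - f y\<bar> < e)"
  using assms(1,2)
proof (induction F)
  case empty
  show ?case by (intro exI[of _ 1]) auto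
next
  case (insert f F)
  then obtain d where d: "d > 0" "\<And>x. (\<forall>i\<in>I. \<bar>x i - y i\<bar> < d) \<Longrightarrow> (\<forall>f\<in>F. \<bar>f x - f y\<bar> < e)" by auto
  have "f \<in> polyfun I" using insert.prems by simp
  then obtain d' where d': "d' > 0" "\<And>x. (\<forall>i\<in>I. \<bar>x i - y i\<bar> < d') \<Longrightarrow> \<bar>f x - f y\<bar> < e"
    using polyfun_continuous[OF _ assms(3)] by blast
  show ?case
  proof (intro exI[of _ "min d d'"] conjI allI impI ballI)
    fix x g assume x: "\<forall>i\<in>I. \<bar>x i - y i\<bar> < min d d'" and g: "g \<in> insert f F"
    from x have "\<forall>i\<in>I. \<bar>x i - y i\<bar> < d" "\<forall>i\<in>I. \<bar>x i - y i\<bar> < d'" by auto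
    then show "\<bar>g x - g y\<bar> < e" using d(2) d'(2) g by blast
  qed (use d(1) d'(1) in simp)
qed

text \<open>Singles out one variable while keeping the coefficients polynomial in the others, which
  is what an induction over the set of variables needs.\<close>

lemma polyfun_as_poly:
  assumes "f \<in> polyfun (insert i I)" "i \<notin> I"
  shows "\<exists>G. (\<forall>x t. f (x(i := t)) = poly (G x) t) \<and> (\<forall>k. (\<lambda>x. coeff (G x) k) \<in> polyfun I)"
  using assms(1)
proof induction
  case (const c)
  show ?case
    by (intro exI[of _ "\<lambda>_. [:c:]"]) (auto intro: polyfun.intros)
next
  case (coord j)
  show ?case
  proof (cases "j = i")
    case True
    then show ?thesis by (intro exI[of _ "\<lambda>_. [:0,1:]"]) (auto intro: polyfun.intros)
  next
    case False
    have "(\<lambda>x. coeff [:x j:] k) \<in> polyfun I" for k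
      using False coord by (cases k) (auto intro: polyfun.intros)
    with False show ?thesis by (intro exI[of _ "\<lambda>x. [:x j:]"]) auto
  qed
next
  case (add f g)
  then obtain F G where "\<forall>x t. f (x(i := t)) = poly (F x) t" "\<forall>k. (\<lambda>x. coeff (F x) k) \<in> polyfun I"
    "\<forall>x t. g (x(i := t)) = poly (G x) t" "\<forall>k. (\<lambda>x. coeff (G x) k) \<in> polyfun I" by blast
  then show ?case
    by (intro exI[of _ "\<lambda>x. F x + G x"]) (auto simp del: fun_upd_apply intro: polyfun.intros)
next
  case (mult f g)
  then obtain F G where "\<forall>x t. f (x(i := t)) = poly (F x) t" "\<forall>k. (\<lambda>x. coeff (F x) k) \<in> polyfun I"
    "\<forall>x t. g (x(i := t)) = poly (G x) t" "\<forall>k. (\<lambda>x. coeff (G x) k) \<in> polyfun I" by blast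
  then show ?case
    by (intro exI[of _ "\<lambda>x. F x * G x"])
      (simp add: coeff_mult polyfun_sum polyfun.mult del: fun_upd_apply)
qed

section \<open>Zero sets of polynomials under the Gaussian product measure\<close>

abbreviation gauss :: "real measure" where
  "gauss \<equiv> density lborel (\<lambda>x. ennreal (std_normal_density x))"

lemma prob_space_gauss: "prob_space gauss"
  by (rule prob_space_normal_density) simp

lemma AE_gauss_finite:
  assumes "finite S"
  shows "AE t in gauss. t \<notin> S"
proof -
  have "AE t in lborel. t \<notin> S"
    using finite_imp_null_set_lborel[OF assms] by (rule AE_not_in)
  then show ?thesis by (subst AE_density) auto
qed

lemma emeasure_gauss_interval_pos:
  assumes "a < b"
  shows "0 < emeasure gauss {a<..<b}"
proof -
  have "emeasure gauss {a<..<b} \<noteq> 0"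
  proof
    assume "emeasure gauss {a<..<b} = 0"
    then have "{a<..<b} \<in> null_sets gauss" by (intro null_setsI) auto
    then have "AE x in lborel. x \<in> {a<..<b} \<longrightarrow> ennreal (std_normal_density x) = 0"
      by (subst (asm) null_sets_density_iff) auto
    then have "AE x in lborel. x \<notin> {a<..<b}"
    proof eventually_elim
      case (elim x)
      have "0 < std_normal_density x" by (rule normal_density_pos) simp
      then show ?case using elim by (auto simp: ennreal_eq_0_iff)
    qed
    then have "{a<..<b} \<in> null_sets lborel"
      by (subst (asm) AE_iff_null_sets[symmetric]) auto
    then show False using assms by (auto simp: null_sets_def)
  qed
  then show ?thesis by (simp add: zero_less_iff_neq_zero)
qed

lemma polyfun_measurable:
  assumes "f \<in> polyfun I"
  shows "f \<in> borel_measurable (PiM I (\<lambda>_. gauss))"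
  using assms
proof induction
  case (coord i)
  then have "(\<lambda>x. x i) \<in> measurable (PiM I (\<lambda>_. gauss)) gauss" by (rule measurable_component_singleton)
  then show ?case by (simp add: measurable_def)
qed auto

text \<open>Induction over the variables with Fubini: a coefficient that is nonzero at
  \<open>y\<close> is nonzero for almost every choice of the other coordinates, and then the new
  coordinate has to avoid only finitely many roots. In each application \<open>y\<close> is an
  explicit tensor.\<close>

lemma AE_polyfun_nonzero:
  assumes "finite I" "f \<in> polyfun I" "f y \<noteq> 0"
  shows "AE x in PiM I (\<lambda>_. gauss). f x \<noteq> 0"
  using assms
proof (induction I arbitrary: f y)
  case empty
  from empty(1) have "f x = f y" for x
    by induction auto
  with empty show ?case by (intro AE_I2) metis
next
  case (insert i I)
  interpret X: prob_space "PiM I (\<lambda>_. gauss)" by (intro prob_space_PiM prob_space_gauss)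
  interpret G: prob_space gauss by (rule prob_space_gauss)
  interpret pair_prob_space gauss "PiM I (\<lambda>_. gauss)" ..
  obtain F where F: "\<And>x t. f (x(i := t)) = poly (F x) t" "\<And>k. (\<lambda>x. coeff (F x) k) \<in> polyfun I"
    using polyfun_as_poly[OF insert.prems(1)] insert.hyps by blast
  have "poly (F y) (y i) \<noteq> 0" using F(1)[of y "y i"] insert.prems by simp
  then have "F y \<noteq> 0" by auto
  then obtain k where "coeff (F y) k \<noteq> 0" by (auto simp: poly_eq_iff)
  from insert.IH[OF F(2) this] have "AE x in PiM I (\<lambda>_. gauss). AE t in gauss. f (x(i := t)) \<noteq> 0"
  proof eventually_elim
    case (elim x)
    then have "F x \<noteq> 0" by auto
    then have "AE t in gauss. t \<notin> {t. poly (F x) t = 0}"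
      by (intro AE_gauss_finite poly_roots_finite)
    then show ?case by (simp add: F)
  qed
  then have ae: "AE x in PiM I (\<lambda>_. gauss). AE t in gauss. f (x(i := t)) \<noteq> 0" .
  have meas: "(\<lambda>(t, x). x(i := t)) \<in> measurable (gauss \<Otimes>\<^sub>M PiM I (\<lambda>_. gauss)) (PiM (insert i I) (\<lambda>_. gauss))"
    unfolding split_def by (rule measurable_fun_upd[where J=I]) auto
  have f[measurable]: "f \<in> borel_measurable (PiM (insert i I) (\<lambda>_. gauss))"
    by (rule polyfun_measurable) fact
  have "(\<lambda>z. f ((snd z)(i := fst z))) \<in> borel_measurable (gauss \<Otimes>\<^sub>M PiM I (\<lambda>_. gauss))"
    using measurable_compose[OF meas f] by (simp add: split_def)
  then have P: "{z \<in> space (gauss \<Otimes>\<^sub>M PiM I (\<lambda>_. gauss)). f ((snd z)(i := fst z)) \<noteq> 0}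
      \<in> sets (gauss \<Otimes>\<^sub>M PiM I (\<lambda>_. gauss))"
    by (rule borel_measurable_neq) (rule borel_measurable_const)
  have "AE t in gauss. AE x in PiM I (\<lambda>_. gauss). f (x(i := t)) \<noteq> 0"
    using ae AE_commute[OF P] by (simp del: fun_upd_apply)
  then have "AE z in gauss \<Otimes>\<^sub>M PiM I (\<lambda>_. gauss). f ((\<lambda>(t, x). x(i := t)) z) \<noteq> 0"
    using AE_pair_iff[OF P] by (simp add: split_def del: fun_upd_apply)
  then have "AE x in distr (gauss \<Otimes>\<^sub>M PiM I (\<lambda>_. gauss)) (PiM (insert i I) (\<lambda>_. gauss)) (\<lambda>(t, x). x(i := t)). f x \<noteq> 0"
    by (subst AE_distr_iff[OF meas borel_measurable_neq[OF f borel_measurable_const]]) simp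
  then show ?case
    by (subst (asm) distr_pair_PiM_eq_PiM) (auto intro: prob_space_gauss)
qed

section \<open>Determinants and adjugates\<close>

definition ndet :: "nat \<Rightarrow> (nat \<Rightarrow> nat \<Rightarrow> real) \<Rightarrow> real" where
  "ndet n f = Determinant.det (Matrix.mat n n (\<lambda>(i, j). f i j))"

definition adj :: "nat \<Rightarrow> (nat \<Rightarrow> nat \<Rightarrow> real) \<Rightarrow> nat \<Rightarrow> nat \<Rightarrow> real" where
  "adj n f i j = adj_mat (Matrix.mat n n (\<lambda>(i, j). f i j)) $$ (i, j)"

lemma ndet_cong:
  assumes "\<And>i j. i < n \<Longrightarrow> j < n \<Longrightarrow> f i j = g i j"
  shows "ndet n f = ndet n g"
  unfolding ndet_def using assms by (intro arg_cong[of _ _ Determinant.det] eq_matI) auto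

lemma ndet_id:
  assumes "\<And>i j. i < n \<Longrightarrow> j < n \<Longrightarrow> f i j = (if i = j then 1 else 0)"
  shows "ndet n f = 1"
proof -
  have "Matrix.mat n n (\<lambda>(i, j). f i j) = 1\<^sub>m n" using assms by auto
  then show ?thesis by (simp add: ndet_def)
qed

lemma ndet_adj:
  assumes "i < n" "j < n"
  shows "(\<Sum>k<n. f i k * adj n f k j) = (if i = j then ndet n f else 0)"
    and "(\<Sum>k<n. adj n f i k * f k j) = (if i = j then ndet n f else 0)"
proof -
  let ?A = "Matrix.mat n n (\<lambda>(i, j). f i j)"
  have A: "?A \<in> carrier_mat n n" by simp
  note adj_mat[OF A]
  then have "(?A * adj_mat ?A) $$ (i, j) = (ndet n f \<cdot>\<^sub>m 1\<^sub>m n) $$ (i, j)"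
    "(adj_mat ?A * ?A) $$ (i, j) = (ndet n f \<cdot>\<^sub>m 1\<^sub>m n) $$ (i, j)" by (simp_all add: ndet_def)
  then show "(\<Sum>k<n. f i k * adj n f k j) = (if i = j then ndet n f else 0)"
    "(\<Sum>k<n. adj n f i k * f k j) = (if i = j then ndet n f else 0)"
    using assms adj_mat(1)[OF A]
    by (auto simp: scalar_prod_def adj_def lessThan_atLeast0)
qed

text \<open>Multiplying the row vector equation by the adjugate turns it into
  \<open>v i * ndet n f = 0\<close>.\<close>

lemma ndet_kernel:
  assumes "ndet n f \<noteq> 0" "\<And>j. j < n \<Longrightarrow> (\<Sum>i<n. v i * f i j) = 0" "i < n"
  shows "v i = 0"
proof -
  have "0 = (\<Sum>j<n. (\<Sum>k<n. v k * f k j) * adj n f j i)" using assms(2) by simp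
  also have "\<dots> = (\<Sum>k<n. v k * (\<Sum>j<n. f k j * adj n f j i))"
    unfolding sum_distrib_left sum_distrib_right by (subst sum.swap) (simp add: mult_ac)
  also have "\<dots> = (\<Sum>k<n. v k * (if k = i then ndet n f else 0))"
    using assms(3) by (intro sum.cong refl) (simp add: ndet_adj)
  also have "\<dots> = v i * ndet n f" using assms(3) by (simp add: if_distrib cong: if_cong)
  finally show ?thesis using assms(1) by simp
qed

text \<open>Padding both factors with zeros to size \<open>n\<close> gives a product of square
  matrices, the second of which has a zero row \<open>r\<close>.\<close>

lemma ndet_low_rank:
  assumes "\<And>i j. i < n \<Longrightarrow> j < n \<Longrightarrow> f i j = (\<Sum>s<r. g i s * h s j)" "r < n"
  shows "ndet n f = 0"
proof -
  let ?A = "Matrix.mat n n (\<lambda>(i, s). if s < r then g i s else 0)"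
  let ?B = "Matrix.mat n n (\<lambda>(s, j). if s < r then h s j else 0)"
  have "Matrix.mat n n (\<lambda>(i, j). f i j) = ?A * ?B"
  proof (rule eq_matI)
    fix i j assume "i < dim_row (?A * ?B)" "j < dim_col (?A * ?B)"
    then have "i < n" "j < n" by auto
    moreover have "(\<Sum>s<r. g i s * h s j) = (\<Sum>s<n. (if s < r then g i s else 0) * (if s < r then h s j else 0))"
      using assms(2) by (intro sum.mono_neutral_cong_left) auto
    ultimately show "Matrix.mat n n (\<lambda>(i, j). f i j) $$ (i, j) = (?A * ?B) $$ (i, j)"
      by (simp add: scalar_prod_def assms(1) lessThan_atLeast0)
  qed auto
  then have *: "ndet n f = Determinant.det ?A * Determinant.det ?B"
    by (simp add: ndet_def det_mult[of _ n])
  have "Determinant.det ?B = 0"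
    using assms(2) by (subst det_def'[of _ n]) (auto intro!: sum.neutral prod_zero bexI[of _ r] dest: permutes_in_image)
  then show ?thesis using * by simp
qed

lemma polyfun_det:
  assumes "\<And>i j. i < n \<Longrightarrow> j < n \<Longrightarrow> (\<lambda>x. A x $$ (i, j)) \<in> polyfun I" "\<And>x. A x \<in> carrier_mat n n"
  shows "(\<lambda>x. Determinant.det (A x)) \<in> polyfun I"
proof -
  have "(\<lambda>x. A x $$ (i, p i)) \<in> polyfun I" if "p permutes {0..<n}" "i \<in> {0..<n}" for p i
    using that permutes_in_image[OF that(1), of i] by (intro assms(1)) auto
  then show ?thesis unfolding det_def'[OF assms(2)]
    by (intro polyfun_sum polyfun.mult polyfun_prod polyfun.const) auto
qed

lemma polyfun_ndet:
  assumes "\<And>i j. i < n \<Longrightarrow> j < n \<Longrightarrow> (\<lambda>x. f x i j) \<in> polyfun I"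
  shows "(\<lambda>x. ndet n (f x)) \<in> polyfun I"
  unfolding ndet_def by (rule polyfun_det[of n]) (auto intro: assms)

lemma polyfun_adj:
  assumes "\<And>i j. i < n \<Longrightarrow> j < n \<Longrightarrow> (\<lambda>x. f x i j) \<in> polyfun I" "i < n" "j < n"
  shows "(\<lambda>x. adj n (f x) i j) \<in> polyfun I"
proof -
  have "(\<lambda>x. Determinant.det (mat_delete (Matrix.mat n n (\<lambda>(i, j). f x i j)) j i)) \<in> polyfun I"
    using assms by (intro polyfun_det[of "n - 1"]) (auto simp: mat_delete_def intro: assms(1))
  then have "(\<lambda>x. (-1)^(j+i) * Determinant.det (mat_delete (Matrix.mat n n (\<lambda>(i, j). f x i j)) j i)) \<in> polyfun I"
    by (intro polyfun.intros)
  then show ?thesis using assms(2,3) by (simp add: adj_def adj_mat_def cofactor_def)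
qed

section \<open>Curves defined by bilinear fixed point equations\<close>

text \<open>Letting \<open>s\<close> tend to 0 from the right kills the constant term; dividing by
  \<open>s\<close> then reduces the order by one.\<close>

lemma coeff_eq_0_if_small:
  fixes p :: "real poly"
  assumes "0 < r" "\<And>s. 0 < s \<Longrightarrow> s \<le> r \<Longrightarrow> \<bar>poly p s\<bar> \<le> B * s ^ n" "j < n"
  shows "coeff p j = 0"
  using assms(2,3)
proof (induction n arbitrary: p j)
  case (Suc n)
  have ev: "eventually (\<lambda>s. s \<in> {0<..r}) (at_right 0)"
    using eventually_at_right_real[OF assms(1)] by eventually_elim auto
  have "((\<lambda>s. B * s ^ Suc n) \<longlongrightarrow> B * 0 ^ Suc n) (at_right (0::real))"
    by (intro tendsto_intros)
  then have "((\<lambda>s. B * s ^ Suc n) \<longlongrightarrow> 0) (at_right (0::real))" by simp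
  then have "((\<lambda>s. poly p s) \<longlongrightarrow> 0) (at_right 0)"
    by (rule Lim_null_comparison[rotated]) (use ev Suc.prems(1) in \<open>auto elim!: eventually_mono\<close>)
  moreover have "((\<lambda>s. poly p s) \<longlongrightarrow> poly p 0) (at_right 0)"
    by (intro tendsto_intros)
  ultimately have "poly p 0 = 0"
    using tendsto_unique trivial_limit_at_right_real by blast
  then obtain q where q: "p = pCons 0 q"
    by (cases p) auto
  have "\<bar>poly q s\<bar> \<le> B * s ^ n" if "0 < s" "s \<le> r" for s
  proof -
    have "s * \<bar>poly q s\<bar> \<le> s * (B * s ^ n)"
      using Suc.prems(1)[OF that] that q by (simp add: abs_mult mult_ac)
    with that show ?thesis by simp
  qed
  from Suc.IH[OF this] Suc.prems(2) show ?case
    by (cases j) (auto simp: q)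
qed simp

text \<open>A bound for the inverse of a Vandermonde matrix, uniform over all nodes in [-1, 1] with
  gaps at least \<open>\<rho>\<close>. Dividing by the linear factor of the last node leaves a
  quotient whose values at the other nodes are at most \<open>2 * e / \<rho>\<close>.\<close>

lemma coeff_le_of_separated_values:
  fixes \<rho> :: real
  assumes "0 < \<rho>"
  shows "\<exists>B>0. \<forall>z p e. (\<forall>i<N. \<bar>z i\<bar> \<le> 1) \<longrightarrow> (\<forall>i<N. \<forall>j<N. i \<noteq> j \<longrightarrow> \<rho> \<le> \<bar>z i - z j\<bar>) \<longrightarrow>
    degree p < N \<longrightarrow> (\<forall>i<N. \<bar>poly p (z i)\<bar> \<le> e) \<longrightarrow> (\<forall>k. \<bar>coeff p k\<bar> \<le> B * (e::real))"
proof (induction N)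
  case 0
  then show ?case by (intro exI[of _ 1]) auto
next
  case (Suc N)
  then obtain B where B: "B > 0" "\<And>z p e k. \<forall>i<N. \<bar>z i\<bar> \<le> 1 \<Longrightarrow> \<forall>i<N. \<forall>j<N. i \<noteq> j \<longrightarrow> \<rho> \<le> \<bar>z i - z j\<bar> \<Longrightarrow>
    degree p < N \<Longrightarrow> \<forall>i<N. \<bar>poly p (z i)\<bar> \<le> e \<Longrightarrow> \<bar>coeff p k\<bar> \<le> B * (e::real)" by blast
  show ?case
  \<comment> \<open>Each coefficient of \<open>p\<close> involves at most two coefficients of the
    quotient, each bounded by \<open>B * (2 * e / \<rho>)\<close>, and one value of
    \<open>p\<close>, bounded by \<open>e\<close>.\<close>
  proof (intro exI[of _ "4 * B / \<rho> + 1"] conjI allI impI)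
    show "4 * B / \<rho> + 1 > 0" using B(1) assms by (simp add: add_pos_pos)
    fix z :: "nat \<Rightarrow> real" and p :: "real poly" and e :: real and k
    assume z: "\<forall>i<Suc N. \<bar>z i\<bar> \<le> 1" "\<forall>i<Suc N. \<forall>j<Suc N. i \<noteq> j \<longrightarrow> \<rho> \<le> \<bar>z i - z j\<bar>"
      and p: "degree p < Suc N" "\<forall>i<Suc N. \<bar>poly p (z i)\<bar> \<le> e"
    define q where "q = synthetic_div p (z N)"
    have pq: "p = [:- z N, 1:] * q + [:poly p (z N):]"
      unfolding q_def by (rule synthetic_div_correct'[symmetric])
    have e: "\<bar>poly p (z N)\<bar> \<le> e" using p(2) by simp
    have qk: "\<bar>coeff q k\<bar> \<le> B * (2 * e / \<rho>)" for k
    proof (cases "degree p = 0")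
      case True
      then have "q = 0" by (simp add: q_def synthetic_div_eq_0_iff)
      then show ?thesis using e B(1) assms by (simp add: divide_nonneg_pos)
    next
      case False
      have "\<bar>poly q (z i)\<bar> \<le> 2 * e / \<rho>" if "i < N" for i
      proof -
        have "poly p (z i) = (z i - z N) * poly q (z i) + poly p (z N)"
          by (subst pq) (simp add: algebra_simps)
        then have "\<bar>z i - z N\<bar> * \<bar>poly q (z i)\<bar> = \<bar>poly p (z i) - poly p (z N)\<bar>"
          by (simp add: abs_mult[symmetric])
        also have "\<dots> \<le> 2 * e"
          using p(2)[rule_format, of i] e that abs_triangle_ineq4[of "poly p (z i)" "poly p (z N)"] by linarith
        finally have "\<bar>z i - z N\<bar> * \<bar>poly q (z i)\<bar> \<le> 2 * e" .
        moreover have "\<rho> * \<bar>poly q (z i)\<bar> \<le> \<bar>z i - z N\<bar> * \<bar>poly q (z i)\<bar>"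
          using z(2) that by (intro mult_right_mono) auto
        ultimately show ?thesis using assms by (simp add: pos_le_divide_eq mult_ac)
      qed
      moreover have "degree q < N" using p(1) False by (simp add: q_def degree_synthetic_div)
      ultimately show ?thesis using z by (intro B(2)[of z]) auto
    qed
    have "\<bar>coeff p k\<bar> \<le> \<bar>coeff q (k - 1)\<bar> + \<bar>z N\<bar> * \<bar>coeff q k\<bar> + \<bar>poly p (z N)\<bar>"
    proof (cases k)
      case 0
      have "coeff p k = - z N * coeff q k + poly p (z N)"
        by (subst pq) (simp add: 0)
      then show ?thesis unfolding abs_mult[symmetric] by linarith
    next
      case (Suc l)
      have "coeff p k = coeff q (k - 1) - z N * coeff q k"
        by (subst pq) (simp add: Suc)
      then show ?thesis unfolding abs_mult[symmetric] by linarith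
    qed
    moreover have "\<bar>z N\<bar> * \<bar>coeff q k\<bar> \<le> 1 * \<bar>coeff q k\<bar>" using z by (intro mult_right_mono) auto
    moreover have "(4 * B / \<rho> + 1) * e = 2 * (B * (2 * e / \<rho>)) + e" by (simp add: field_simps)
    ultimately show "\<bar>coeff p k\<bar> \<le> (4 * B / \<rho> + 1) * e"
      using qk[of k] qk[of "k-1"] e by linarith
  qed
qed

text \<open>The curves of rank-one matrices studied below are the solutions of
  \<open>c 0 = s\<close> and \<open>c k = (\<Sum>k'. U k k' * c k') * (\<Sum>k'. V k k' * c k')\<close> for \<open>1 \<le> k \<le> K\<close>, where \<open>s\<close> is a
  small parameter. For small \<open>s\<close> this is the fixed point equation of a contraction, and the Picard
  iterates are polynomials in \<open>s\<close> whose coefficients are polynomials in \<open>U\<close> and \<open>V\<close>.\<close>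

definition step :: "nat \<Rightarrow> (nat \<Rightarrow> nat \<Rightarrow> real) \<Rightarrow> (nat \<Rightarrow> nat \<Rightarrow> real) \<Rightarrow> real \<Rightarrow> (nat \<Rightarrow> real) \<Rightarrow> nat \<Rightarrow> real" where
  "step K U V s c k = (if k = 0 then s else (\<Sum>k'\<le>K. U k k' * c k') * (\<Sum>k'\<le>K. V k k' * c k'))"

text \<open>The bound selects the small solution, as the quadratic equations may have large ones
  too. At \<open>k = 0\<close> it forces \<open>s\<close> to be nonnegative.\<close>

definition curve_pt :: "nat \<Rightarrow> (nat \<Rightarrow> nat \<Rightarrow> real) \<Rightarrow> (nat \<Rightarrow> nat \<Rightarrow> real) \<Rightarrow> real \<Rightarrow> (nat \<Rightarrow> real) \<Rightarrow> bool" where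
  "curve_pt K U V s c \<longleftrightarrow> (\<forall>k\<le>K. c k = step K U V s c k \<and> \<bar>c k\<bar> \<le> s)"

primrec picard :: "nat \<Rightarrow> (nat \<Rightarrow> nat \<Rightarrow> real) \<Rightarrow> (nat \<Rightarrow> nat \<Rightarrow> real) \<Rightarrow> nat \<Rightarrow> nat \<Rightarrow> real poly" where
  "picard K U V 0 k = (if k = 0 then [:0, 1:] else 0)"
| "picard K U V (Suc n) k = (if k = 0 then [:0, 1:] else
    (\<Sum>k'\<le>K. Polynomial.smult (U k k') (picard K U V n k')) * (\<Sum>k'\<le>K. Polynomial.smult (V k k') (picard K U V n k')))"

lemma poly_picard_Suc: "poly (picard K U V (Suc n) k) s = step K U V s (\<lambda>k. poly (picard K U V n k) s) k"
  by (simp add: step_def poly_sum)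

lemma poly_picard_zero_index: "poly (picard K U V n 0) s = s"
  by (cases n) auto

lemma polyfun_coeff_picard:
  assumes "\<And>k k'. k \<le> K \<Longrightarrow> k' \<le> K \<Longrightarrow> (\<lambda>x. U x k k') \<in> polyfun I"
    "\<And>k k'. k \<le> K \<Longrightarrow> k' \<le> K \<Longrightarrow> (\<lambda>x. V x k k') \<in> polyfun I" "k \<le> K"
  shows "(\<lambda>x. coeff (picard K (U x) (V x) n k) j) \<in> polyfun I"
  using assms(3)
proof (induction n arbitrary: k j)
  case 0
  then show ?case by (auto intro: polyfun.const)
next
  case (Suc n)
  show ?case
  proof (cases "k = 0")
    case True
    then show ?thesis by (auto intro: polyfun.const)
  next
    case False
    with Suc assms(1,2) show ?thesis
      by (simp add: coeff_mult coeff_sum) (intro polyfun_sum polyfun.mult; simp)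
  qed
qed

lemma picard_cong:
  assumes "\<And>k k'. k \<le> K \<Longrightarrow> k' \<le> K \<Longrightarrow> U k k' = U' k k'" "\<And>k k'. k \<le> K \<Longrightarrow> k' \<le> K \<Longrightarrow> V k k' = V' k k'" "k \<le> K"
  shows "picard K U V n k = picard K U' V' n k"
  using assms(3)
proof (induction n arbitrary: k)
  case (Suc n)
  have "(\<Sum>k'\<le>K. Polynomial.smult (U k k') (picard K U V n k')) = (\<Sum>k'\<le>K. Polynomial.smult (U' k k') (picard K U' V' n k'))"
    "(\<Sum>k'\<le>K. Polynomial.smult (V k k') (picard K U V n k')) = (\<Sum>k'\<le>K. Polynomial.smult (V' k k') (picard K U' V' n k'))"
    using Suc assms(1,2) by (auto intro!: sum.cong)
  then show ?case by (simp only: picard.simps)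
qed simp

text \<open>\<open>A\<close> bounds the operator norms of \<open>U\<close> and \<open>V\<close> for
  the maximum norm. On the ball of radius \<open>\<rho>\<close> the components
  \<open>k \<noteq> 0\<close> of \<open>step\<close> have Lipschitz constant
  \<open>2 * A^2 * \<rho>\<close>, so the recurring condition \<open>4 * A^2 * s \<le> 1\<close>
  means contraction by a factor 1/2.\<close>

locale curve =
  fixes K :: nat and U V :: "nat \<Rightarrow> nat \<Rightarrow> real" and A :: real
  assumes rowU: "\<And>k. k \<le> K \<Longrightarrow> (\<Sum>k'\<le>K. \<bar>U k k'\<bar>) \<le> A"
    and rowV: "\<And>k. k \<le> K \<Longrightarrow> (\<Sum>k'\<le>K. \<bar>V k k'\<bar>) \<le> A"
begin

lemma A_nonneg: "0 \<le> A"
  using rowU[of 0] by (rule order_trans[OF sum_nonneg, rotated]) auto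

lemma row_bound:
  assumes "\<And>k. k \<le> K \<Longrightarrow> \<bar>c k\<bar> \<le> \<rho>" "k \<le> K"
  shows "\<bar>\<Sum>k'\<le>K. U k k' * c k'\<bar> \<le> A * \<rho>" "\<bar>\<Sum>k'\<le>K. V k k' * c k'\<bar> \<le> A * \<rho>"
proof -
  have \<rho>: "0 \<le> \<rho>" using assms(1)[of 0] by simp
  have *: "\<bar>\<Sum>k'\<le>K. W k k' * c k'\<bar> \<le> A * \<rho>" if "(\<Sum>k'\<le>K. \<bar>W k k'\<bar>) \<le> A" for W :: "nat \<Rightarrow> nat \<Rightarrow> real"
  proof -
    have "\<bar>\<Sum>k'\<le>K. W k k' * c k'\<bar> \<le> (\<Sum>k'\<le>K. \<bar>W k k'\<bar> * \<rho>)"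
      by (rule order_trans[OF sum_abs]) (auto simp: abs_mult intro!: sum_mono mult_left_mono assms)
    also have "\<dots> \<le> A * \<rho>" using that \<rho> by (simp add: sum_distrib_right[symmetric] mult_right_mono)
    finally show ?thesis .
  qed
  show "\<bar>\<Sum>k'\<le>K. U k k' * c k'\<bar> \<le> A * \<rho>" "\<bar>\<Sum>k'\<le>K. V k k' * c k'\<bar> \<le> A * \<rho>"
    by (rule *; use rowU rowV assms(2) in blast)+
qed

lemma step_lipschitz:
  assumes "\<And>k. k \<le> K \<Longrightarrow> \<bar>c k\<bar> \<le> \<rho>" "\<And>k. k \<le> K \<Longrightarrow> \<bar>d k\<bar> \<le> \<rho>"
    "\<And>k. k \<le> K \<Longrightarrow> \<bar>c k - d k\<bar> \<le> e" "k \<le> K" "k \<noteq> 0"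
  shows "\<bar>step K U V s c k - step K U V s' d k\<bar> \<le> 2 * A^2 * \<rho> * e"
proof -
  let ?u = "\<lambda>c. \<Sum>k'\<le>K. U k k' * c k'" and ?v = "\<lambda>c. \<Sum>k'\<le>K. V k k' * c k'"
  have "0 \<le> \<rho>" using assms(1)[of 0] by simp
  have "0 \<le> e" using assms(3)[of 0] by simp
  have "?u c * ?v c - ?u d * ?v d = ?u c * ?v (\<lambda>k. c k - d k) + ?u (\<lambda>k. c k - d k) * ?v d"
    by (simp add: algebra_simps sum_subtractf)
  also have "\<bar>\<dots>\<bar> \<le> (A * \<rho>) * (A * e) + (A * e) * (A * \<rho>)"
    using row_bound[of c \<rho> k] row_bound[of d \<rho> k] row_bound[of "\<lambda>k. c k - d k" e k] assms
      A_nonneg \<open>0 \<le> \<rho>\<close> \<open>0 \<le> e\<close>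
    by (intro order_trans[OF abs_triangle_ineq] add_mono)
      (auto simp: abs_mult intro!: mult_mono)
  finally show ?thesis using assms(5) by (simp add: step_def power2_eq_square mult_ac)
qed

lemma step_bound:
  assumes "\<And>k. k \<le> K \<Longrightarrow> \<bar>c k\<bar> \<le> s" "k \<le> K" "A^2 * s \<le> 1"
  shows "\<bar>step K U V s c k\<bar> \<le> s"
proof (cases "k = 0")
  case True
  then show ?thesis using assms(1)[of 0] by (simp add: step_def)
next
  case False
  have s: "0 \<le> s" using assms(1)[of 0] by simp
  have "\<bar>step K U V s c k\<bar> \<le> (A * s) * (A * s)"
    unfolding step_def using False row_bound[OF assms(1,2)]
      s A_nonneg by (auto simp: abs_mult intro!: mult_mono)
  also have "\<dots> = (A^2 * s) * s" by (simp add: power2_eq_square)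
  also have "\<dots> \<le> 1 * s" using assms(3) s by (rule mult_right_mono)
  finally show ?thesis by simp
qed

lemma picard_bound:
  assumes "0 \<le> s" "A^2 * s \<le> 1" "k \<le> K"
  shows "\<bar>poly (picard K U V n k) s\<bar> \<le> s"
  using assms(3)
proof (induction n arbitrary: k)
  case (Suc n)
  then show ?case unfolding poly_picard_Suc by (intro step_bound assms) auto
qed (use assms in auto)

lemma picard_diff:
  assumes "0 \<le> s" "4 * A^2 * s \<le> 1" "k \<le> K"
  shows "\<bar>poly (picard K U V (Suc n) k) s - poly (picard K U V n k) s\<bar> \<le> s * (1/2)^n"
  using assms(3)
proof (induction n arbitrary: k)
  case 0
  have "A^2 * s \<le> 1" using assms(1,2) mult_nonneg_nonneg[OF zero_le_power2[of A], of s] by linarith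
  with 0 show ?case
    using assms(1) picard_bound[of s k "Suc 0"] by (cases "k = 0") (auto simp del: picard.simps(2) simp: poly_picard_zero_index)
next
  case (Suc n)
  have a: "A^2 * s \<le> 1" using assms(1,2) mult_nonneg_nonneg[OF zero_le_power2[of A], of s] by linarith
  show ?case
  proof (cases "k = 0")
    case True
    then show ?thesis using assms(1) by (simp only: poly_picard_zero_index) simp
  next
    case False
    have "\<bar>poly (picard K U V (Suc (Suc n)) k) s - poly (picard K U V (Suc n) k) s\<bar> \<le> 2 * A^2 * s * (s * (1/2)^n)"
      by (subst (1 2) poly_picard_Suc, rule step_lipschitz)
        (use Suc False picard_bound[OF assms(1) a] in \<open>auto simp del: picard.simps\<close>)
    also have "\<dots> \<le> (1/2) * (s * (1/2)^n)"
      using assms(1,2) by (intro mult_right_mono) auto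
    finally show ?thesis by simp
  qed
qed

lemma curve_pt_exists:
  assumes "0 \<le> s" "4 * A^2 * s \<le> 1"
  shows "\<exists>c. curve_pt K U V s c"
proof -
  have a: "A^2 * s \<le> 1" using assms(1,2) mult_nonneg_nonneg[OF zero_le_power2[of A], of s] by linarith
  let ?x = "\<lambda>k n. poly (picard K U V n k) s"
  have "convergent (?x k)" if "k \<le> K" for k
  proof -
    have "summable (\<lambda>n. ?x k (Suc n) - ?x k n)"
      by (rule summable_comparison_test'[where g="\<lambda>n. s * (1/2)^n" and N=0])
        (use picard_diff[OF assms that] in \<open>auto simp del: picard.simps intro!: summable_mult summable_geometric\<close>)
    then have "convergent (\<lambda>n. \<Sum>i<n. ?x k (Suc i) - ?x k i)"
      by (simp only: summable_iff_convergent)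
    then have "convergent (\<lambda>n. ?x k n - ?x k 0)"
      by (simp only: sum_lessThan_telescope[of "?x k"])
    then show ?thesis by (simp only: convergent_diff_const_right_iff)
  qed
  then have "\<forall>k. \<exists>c. k \<le> K \<longrightarrow> ?x k \<longlonglongrightarrow> c" unfolding convergent_def by blast
  then obtain c where c: "\<And>k. k \<le> K \<Longrightarrow> ?x k \<longlonglongrightarrow> c k" by metis
  have "c k = step K U V s c k \<and> \<bar>c k\<bar> \<le> s" if k: "k \<le> K" for k
  proof
    have "(\<lambda>n. step K U V s (\<lambda>k. ?x k n) k) \<longlonglongrightarrow> step K U V s c k"
      unfolding step_def by (cases "k = 0") (auto intro!: tendsto_intros c)
    then have "(\<lambda>n. ?x k (Suc n)) \<longlonglongrightarrow> step K U V s c k" by (simp only: poly_picard_Suc)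
    then show "c k = step K U V s c k" using c[OF k] LIMSEQ_Suc LIMSEQ_unique by blast
    show "\<bar>c k\<bar> \<le> s"
      using tendsto_rabs[OF c[OF k]] by (rule LIMSEQ_le_const2) (use picard_bound[OF assms(1) a k] in auto)
  qed
  then show ?thesis unfolding curve_pt_def by blast
qed

text \<open>Here \<open>d\<close> solves the equation only up to a defect \<open>e\<close>, possibly
  for another parameter. At the index of the largest deviation \<open>D\<close>, contraction gives
  \<open>D \<le> D / 2 + e\<close>. With \<open>e = 0\<close> this yields continuity in the
  parameter, with \<open>s = s'\<close> stability under perturbation of \<open>U\<close> and
  \<open>V\<close>.\<close>

lemma curve_pt_stable:
  assumes c: "\<And>k. k \<le> K \<Longrightarrow> c k = step K U V s c k" "\<And>k. k \<le> K \<Longrightarrow> \<bar>c k\<bar> \<le> \<rho>"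
    and d: "\<And>k. k \<le> K \<Longrightarrow> \<bar>d k - step K U V s' d k\<bar> \<le> e" "\<And>k. k \<le> K \<Longrightarrow> \<bar>d k\<bar> \<le> \<rho>"
    and \<rho>: "4 * A^2 * \<rho> \<le> 1" and k: "k \<le> K"
  shows "\<bar>c k - d k\<bar> \<le> \<bar>s - s'\<bar> + 2 * e"
proof -
  define D where "D = Max ((\<lambda>k. \<bar>c k - d k\<bar>) ` {..K})"
  have D: "\<bar>c k - d k\<bar> \<le> D" if "k \<le> K" for k
    unfolding D_def using that by (intro Max_ge) auto
  have "D \<in> (\<lambda>k. \<bar>c k - d k\<bar>) ` {..K}" unfolding D_def by (intro Max_in) auto
  then obtain k0 where k0: "k0 \<le> K" "D = \<bar>c k0 - d k0\<bar>" by auto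
  have e: "0 \<le> e" using d(1)[OF k] by linarith
  have "D \<le> \<bar>s - s'\<bar> + 2 * e"
  proof (cases "k0 = 0")
    case True
    then show ?thesis using c(1)[OF k0(1)] d(1)[OF k0(1)] k0(2) e by (simp add: step_def)
  next
    case False
    have "\<bar>step K U V s c k0 - step K U V s' d k0\<bar> \<le> 2 * A^2 * \<rho> * D"
      using c(2) d(2) D k0(1) False by (intro step_lipschitz) auto
    also have "\<dots> \<le> (1/2) * D"
      using \<rho> k0(2) by (intro mult_right_mono) auto
    finally show ?thesis using k0 d(1)[OF k0(1)] c(1)[OF k0(1)] e by linarith
  qed
  then show ?thesis using D[OF k] by linarith
qed

text \<open>Every iteration gains a factor \<open>2 * A^2 * s\<close>. For \<open>n = K + 1\<close>
  the error has order \<open>s ^ (K + 2)\<close>, just beyond the coefficients that enter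
  \<open>jetdet\<close>.\<close>

lemma curve_pt_picard:
  assumes "curve_pt K U V s c" "4 * A^2 * s \<le> 1" "k \<le> K"
  shows "\<bar>c k - poly (picard K U V n k) s\<bar> \<le> (2 * A^2) ^ n * s ^ (n + 1)"
  using assms(3)
proof (induction n arbitrary: k)
  case 0
  have "0 \<le> s" using assms(1) unfolding curve_pt_def by force
  moreover have "c k = step K U V s c k" "\<bar>c k\<bar> \<le> s" using assms(1) 0 unfolding curve_pt_def by blast+
  ultimately show ?case by (cases "k = 0") (auto simp: step_def)
next
  case (Suc n)
  have s: "0 \<le> s" using assms(1) unfolding curve_pt_def by force
  have a: "A^2 * s \<le> 1" using assms(2) mult_nonneg_nonneg[OF zero_le_power2[of A] s] by linarith
  show ?case
  proof (cases "k = 0")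
    case True
    then show ?thesis using assms(1) s unfolding curve_pt_def
      by (auto simp del: picard.simps simp: poly_picard_zero_index step_def)
  next
    case False
    have "\<bar>step K U V s c k - step K U V s (\<lambda>k. poly (picard K U V n k) s) k\<bar>
        \<le> 2 * A^2 * s * ((2 * A^2) ^ n * s ^ (n + 1))"
      using Suc assms(1) False picard_bound[OF s a] unfolding curve_pt_def
      by (intro step_lipschitz) auto
    also have "\<dots> = (2 * A^2) ^ Suc n * s ^ (Suc n + 1)" by simp
    finally show ?thesis using assms(1) Suc.prems unfolding curve_pt_def poly_picard_Suc by metis
  qed
qed

end

text \<open>The iterate of order \<open>K + 1\<close> has the true Taylor coefficients of the curve up to \<open>s ^ (K + 1)\<close>;
  those of order \<open>0\<close> vanish, so the relevant matrix starts with the coefficients of \<open>s\<close>.\<close>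

definition jetdet :: "nat \<Rightarrow> (nat \<Rightarrow> nat \<Rightarrow> real) \<Rightarrow> (nat \<Rightarrow> nat \<Rightarrow> real) \<Rightarrow> real" where
  "jetdet K U V = ndet (Suc K) (\<lambda>k j. coeff (picard K U V (Suc K) k) (Suc j))"

lemma jetdet_cong:
  assumes "\<And>k k'. k \<le> K \<Longrightarrow> k' \<le> K \<Longrightarrow> U k k' = U' k k'" "\<And>k k'. k \<le> K \<Longrightarrow> k' \<le> K \<Longrightarrow> V k k' = V' k k'"
  shows "jetdet K U V = jetdet K U' V'"
  unfolding jetdet_def using picard_cong[OF assms] by (intro ndet_cong) (simp del: picard.simps)

text \<open>Applied to the Picard polynomials, a form vanishing on the curve is of order
  \<open>s ^ (K + 2)\<close>. Hence its coefficients up to \<open>s ^ (K + 1)\<close> are zero,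
  which says that \<open>v\<close> annihilates the matrix of \<open>jetdet\<close>.\<close>

lemma (in curve) jetdet_independent_on_curve:
  assumes "jetdet K U V \<noteq> 0"
    and "\<And>s c. 0 < s \<Longrightarrow> curve_pt K U V s c \<Longrightarrow> (\<Sum>k\<le>K. v k * c k) = 0"
    and "k \<le> K"
  shows "v k = 0"
proof -
  define r where "r = 1 / (4 * A^2 + 1)"
  have den: "0 < 4 * A^2 + 1" using zero_le_power2[of A] by linarith
  have r: "0 < r" "4 * A^2 * r \<le> 1" using den by (auto simp: r_def divide_simps)
  define P where "P = picard K U V (Suc K)"
  define B where "B = (2 * A^2) ^ Suc K"
  let ?p = "\<Sum>k\<le>K. Polynomial.smult (v k) (P k)"
  have small: "\<bar>poly ?p s\<bar> \<le> ((\<Sum>k\<le>K. \<bar>v k\<bar>) * B) * s ^ (K + 2)" if s: "0 < s" "s \<le> r" for s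
  proof -
    have s4: "4 * A^2 * s \<le> 1" using r(2) s mult_left_mono[of s r "4 * A^2"] by auto
    then obtain c where c: "curve_pt K U V s c" using curve_pt_exists[of s] s by auto
    have "poly ?p s = (\<Sum>k\<le>K. v k * (poly (P k) s - c k))"
      using assms(2)[OF s(1) c] by (simp add: poly_sum algebra_simps sum_subtractf)
    also have "\<bar>\<dots>\<bar> \<le> (\<Sum>k\<le>K. \<bar>v k\<bar> * (B * s ^ (K + 2)))"
      using curve_pt_picard[OF c s4, of _ "Suc K", folded P_def, folded B_def]
      by (intro order_trans[OF sum_abs] sum_mono) (auto simp: abs_mult abs_minus_commute intro!: mult_left_mono)
    finally show ?thesis by (simp only: sum_distrib_right mult.assoc)
  qed
  have "coeff ?p (Suc j) = 0" if "j < Suc K" for j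
    by (rule coeff_eq_0_if_small[OF r(1) small]) (use that in auto)
  then have "(\<Sum>k<Suc K. v k * coeff (P k) (Suc j)) = 0" if "j < Suc K" for j
    using that by (simp add: coeff_sum lessThan_Suc_atMost)
  then show ?thesis
    using assms(1,3) unfolding jetdet_def P_def by (intro ndet_kernel[of "Suc K" _ v]) auto
qed

section \<open>The monomial curve and its perturbations\<close>

text \<open>Special coefficients for which the curve is the monomial curve \<open>c k = s ^ (k + 1)\<close>:
  the product \<open>s ^ (i + 1) * s ^ (j * M + 1)\<close> with \<open>i < M\<close> is \<open>s ^ (k + 1)\<close> for \<open>k = i + j * M + 1\<close>.\<close>

definition monU :: "nat \<Rightarrow> nat \<Rightarrow> nat \<Rightarrow> real" where
  "monU M k k' = (if k' = (k - 1) mod M then 1 else 0)"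

definition monV :: "nat \<Rightarrow> nat \<Rightarrow> nat \<Rightarrow> real" where
  "monV M k k' = (if k' = (k - 1) div M * M then 1 else 0)"

lemma mon_index_le:
  assumes "k \<le> K" shows "(k - 1) mod M \<le> K" "(k - 1) div M * M \<le> (K::nat)"
  using assms mod_less_eq_dividend[of "k - 1" M] div_times_less_eq_dividend[of "k - 1" M] by linarith+

lemma mon_sum:
  assumes "k \<le> K"
  shows "(\<Sum>k'\<le>K. monU M k k' * c k') = c ((k - 1) mod M)"
    "(\<Sum>k'\<le>K. monV M k k' * c k') = c ((k - 1) div M * M)"
  using mon_index_le[OF assms, of M] by (simp_all add: monU_def monV_def if_distrib[of "\<lambda>x. x * _"] cong: if_cong)

lemma step_mon:
  assumes "k \<le> K"
  shows "step K (monU M) (monV M) s (\<lambda>k. s ^ (k + 1)) k = s ^ (k + 1)"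
proof (cases "k = 0")
  case False
  have "s ^ (a + 1) * s ^ (b + 1) = s ^ ((b + a) + 2)" for a b
    by (simp add: power_add power2_eq_square)
  then have "s ^ ((k - 1) mod M + 1) * s ^ ((k - 1) div M * M + 1) = s ^ (((k - 1) div M * M + (k - 1) mod M) + 2)" .
  also have "((k - 1) div M * M + (k - 1) mod M) + 2 = k + 1" using False by simp
  finally show ?thesis using False by (simp only: step_def mon_sum[OF assms] if_False)
qed (simp add: step_def)

lemma curve_pt_mon:
  assumes "0 \<le> s" "s \<le> 1"
  shows "curve_pt K (monU M) (monV M) s (\<lambda>k. s ^ (k + 1))"
proof -
  have "s ^ (k + 1) \<le> s" for k using power_decreasing[of 1 "k + 1" s] assms by simp
  then show ?thesis unfolding curve_pt_def
    using assms step_mon[symmetric] by (intro allI impI conjI) auto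
qed

text \<open>The Picard polynomial of index \<open>k\<close> agrees with \<open>s ^ (k + 1)\<close>
  up to order \<open>s ^ (K + 2)\<close>, so the matrix of coefficients is the identity.\<close>

lemma jetdet_mon: "jetdet K (monU M) (monV M) = 1"
  unfolding jetdet_def
proof (rule ndet_id)
  interpret curve K "monU M" "monV M" 1
  proof
    fix k assume "k \<le> K"
    from mon_sum[OF this, of M "\<lambda>_. 1"]
    show "(\<Sum>k'\<le>K. \<bar>monU M k k'\<bar>) \<le> 1" "(\<Sum>k'\<le>K. \<bar>monV M k k'\<bar>) \<le> 1"
      by (simp_all add: monU_def monV_def if_distrib[of abs] cong: if_cong)
  qed
  fix k j assume kj: "k < Suc K" "j < Suc K"
  define P where "P = picard K (monU M) (monV M) (Suc K) k"
  have "\<bar>poly (P - Polynomial.monom 1 (k + 1)) s\<bar> \<le> 2 ^ Suc K * s ^ (K + 2)" if "0 < s" "s \<le> 1/4" for s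
    using curve_pt_picard[OF curve_pt_mon, of s k "Suc K", folded P_def] that kj
    by (simp add: poly_monom abs_minus_commute)
  then have "coeff (P - Polynomial.monom 1 (k + 1)) (Suc j) = 0"
    using kj by (intro coeff_eq_0_if_small[of "1/4" _ "2 ^ Suc K" "K + 2"]) auto
  then show "coeff (picard K (monU M) (monV M) (Suc K) k) (Suc j) = (if k = j then 1 else 0)"
    unfolding P_def[symmetric] by (auto split: if_splits)
qed

text \<open>Frees the criterion from \<open>A\<close> and from smallness: a form vanishing on all
  solutions of the equations vanishes in particular on the curve.\<close>

lemma jetdet_independent:
  assumes "jetdet K U V \<noteq> 0"
    and "\<And>c. (\<And>k. k \<le> K \<Longrightarrow> k \<noteq> 0 \<Longrightarrow> c k = (\<Sum>k'\<le>K. U k k' * c k') * (\<Sum>k'\<le>K. V k k' * c k')) \<Longrightarrow> (\<Sum>k\<le>K. v k * c k) = 0"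
    and "k \<le> K"
  shows "v k = 0"
proof -
  define A where "A = (\<Sum>k\<le>K. \<Sum>k'\<le>K. \<bar>U k k'\<bar> + \<bar>V k k'\<bar>)"
  interpret curve K U V A
  proof
    fix k assume "k \<le> K"
    then have *: "(\<Sum>k'\<le>K. \<bar>U k k'\<bar> + \<bar>V k k'\<bar>) \<le> A"
      unfolding A_def by (intro member_le_sum[of k _ "\<lambda>k. \<Sum>k'\<le>K. \<bar>U k k'\<bar> + \<bar>V k k'\<bar>"]) (auto intro!: sum_nonneg)
    show "(\<Sum>k'\<le>K. \<bar>U k k'\<bar>) \<le> A" by (rule order_trans[OF sum_mono *]) auto
    show "(\<Sum>k'\<le>K. \<bar>V k k'\<bar>) \<le> A" by (rule order_trans[OF sum_mono *]) auto
  qed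
  show ?thesis
  proof (rule jetdet_independent_on_curve[OF assms(1) _ assms(3)])
    fix s c assume "curve_pt K U V s c"
    then have "c k = step K U V s c k" if "k \<le> K" for k using that unfolding curve_pt_def by blast
    then show "(\<Sum>k\<le>K. v k * c k) = 0" by (intro assms(2)) (simp add: step_def)
  qed
qed

lemma step_perturb:
  assumes "curve K U V A" "curve K U' V' A" "0 \<le> e"
    and "\<And>k k'. k \<le> K \<Longrightarrow> k' \<le> K \<Longrightarrow> \<bar>U k k' - U' k k'\<bar> \<le> e"
    and "\<And>k k'. k \<le> K \<Longrightarrow> k' \<le> K \<Longrightarrow> \<bar>V k k' - V' k k'\<bar> \<le> e"
    and "\<And>k. k \<le> K \<Longrightarrow> \<bar>c k\<bar> \<le> \<rho>" "k \<le> K"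
  shows "\<bar>step K U V s c k - step K U' V' s c k\<bar> \<le> 2 * A * \<rho> * ((real K + 1) * e * \<rho>)"
proof -
  have \<rho>: "0 \<le> \<rho>" using assms(6)[of 0] by simp
  have A: "0 \<le> A" by (rule curve.A_nonneg) fact
  have *: "\<bar>(\<Sum>k'\<le>K. W k k' * c k') - (\<Sum>k'\<le>K. W' k k' * c k')\<bar> \<le> (real K + 1) * e * \<rho>"
    if "\<And>k'. k' \<le> K \<Longrightarrow> \<bar>W k k' - W' k k'\<bar> \<le> e" for W W' :: "nat \<Rightarrow> nat \<Rightarrow> real"
  proof -
    have "\<bar>(\<Sum>k'\<le>K. W k k' * c k') - (\<Sum>k'\<le>K. W' k k' * c k')\<bar> = \<bar>\<Sum>k'\<le>K. (W k k' - W' k k') * c k'\<bar>"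
      by (simp add: sum_subtractf left_diff_distrib)
    also have "\<dots> \<le> (\<Sum>k'\<le>K. e * \<rho>)"
      by (rule order_trans[OF sum_abs], rule sum_mono, unfold abs_mult)
        (use that assms(3,6) in \<open>auto intro!: mult_mono\<close>)
    finally show ?thesis by (simp add: algebra_simps)
  qed
  let ?E = "(real K + 1) * e * \<rho>"
  let ?u = "\<Sum>k'\<le>K. U k k' * c k'" and ?v = "\<Sum>k'\<le>K. V k k' * c k'"
  let ?u' = "\<Sum>k'\<le>K. U' k k' * c k'" and ?v' = "\<Sum>k'\<le>K. V' k k' * c k'"
  have E: "0 \<le> ?E" using \<rho> assms(3) by simp
  have u: "\<bar>?u - ?u'\<bar> \<le> ?E" using assms(4,7) by (intro *) auto
  have v: "\<bar>?v - ?v'\<bar> \<le> ?E" using assms(5,7) by (intro *) auto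
  have "?u * ?v - ?u' * ?v' = ?u * (?v - ?v') + (?u - ?u') * ?v'" by (simp add: algebra_simps)
  also have "\<bar>\<dots>\<bar> \<le> (A * \<rho>) * ?E + ?E * (A * \<rho>)"
    using curve.row_bound[OF assms(1,6,7)] curve.row_bound[OF assms(2,6,7)] u v A \<rho> E
    by (intro order_trans[OF abs_triangle_ineq] add_mono) (auto simp only: abs_mult intro!: mult_mono mult_nonneg_nonneg abs_ge_zero)
  also have "A * \<rho> * ?E + ?E * (A * \<rho>) = 2 * A * \<rho> * ?E" by (simp add: algebra_simps)
  finally have "\<bar>?u * ?v - ?u' * ?v'\<bar> \<le> 2 * A * \<rho> * ?E" .
  moreover have "0 \<le> 2 * A * \<rho> * ?E" using assms(3) A \<rho> by (intro mult_nonneg_nonneg) auto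
  ultimately show ?thesis by (cases "k = 0") (simp_all only: step_def if_True if_False simp_thms diff_self abs_zero)
qed

text \<open>The level \<open>1\<close> is chosen such that, on the monomial curve, \<open>\<Sum>k. \<tau>0 k * s ^ (k + 1) = 1\<close> has
  \<open>K + 1\<close> simple, well separated zeros \<open>z0 j\<close>. By the intermediate value theorem they persist under
  perturbation, and stay in disjoint intervals, so that an approximate Vandermonde argument applies.\<close>

lemma near_mon_independent:
  "\<exists>\<tau>0 \<eta>. 0 < \<eta> \<and> (\<forall>U V \<tau> v.
    (\<forall>k\<le>K. \<forall>k'\<le>K. \<bar>U k k' - monU M k k'\<bar> \<le> \<eta> \<and> \<bar>V k k' - monV M k k'\<bar> \<le> \<eta>) \<longrightarrow>
    (\<forall>k\<le>K. \<bar>\<tau> k - \<tau>0 k\<bar> \<le> \<eta>) \<longrightarrow>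
    (\<forall>c. (\<forall>k\<le>K. k \<noteq> 0 \<longrightarrow> c k = (\<Sum>k'\<le>K. U k k' * c k') * (\<Sum>k'\<le>K. V k k' * c k')) \<longrightarrow>
      (\<Sum>k\<le>K. \<tau> k * c k) = 1 \<longrightarrow> (\<Sum>k\<le>K. v k * c k) = 0) \<longrightarrow>
    (\<forall>k\<le>K. v k = (0::real)))"
proof -
  \<comment> \<open>The nodes \<open>w, 2 * w, ..., (K + 1) * w\<close> and the brackets around them
    stay below \<open>w * (K + 2) = 1/16\<close>, where curves with row bound 2 exist, since
    \<open>4 * 2^2 / 16 = 1\<close>.\<close>
  define w where "w = 1 / (16 * (real K + 2))"
  have w: "0 < w" "w * (real K + 2) = 1/16" by (auto simp: w_def)
  define z0 where "z0 j = w * (real j + 1)" for j :: nat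
  \<comment> \<open>Brackets of half-width \<open>w / 4\<close> around the nodes leave gaps of at
    least \<open>w / 2\<close> between each other and to the point 0.\<close>
  define lo where "lo j = w * (real j + 3/4)" for j :: nat
  define hi where "hi j = w * (real j + 5/4)" for j :: nat
  have lohi: "0 < lo j" "lo j < hi j" for j using w by (auto simp: lo_def hi_def)
  have hi1: "hi j \<le> 1/16" if "j \<le> K" for j
  proof -
    have "hi j \<le> w * (real K + 2)" unfolding hi_def using that w by (intro mult_left_mono) auto
    then show ?thesis using w by simp
  qed
  \<comment> \<open>Normalised to constant term 1, so that \<open>1 - q\<close> is a linear form in
    the coordinates \<open>s ^ (k + 1)\<close> of the monomial curve; its coefficients are
    \<open>\<tau>0\<close>.\<close>
  define q where "q = (\<Prod>j\<le>K. [:1, - 1 / z0 j:])"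
  have polyq: "poly q s = (\<Prod>j\<le>K. 1 - s / z0 j)" for s by (simp add: q_def poly_prod)
  have z0: "0 < z0 j" for j using w by (simp add: z0_def)
  have degq: "degree q \<le> K + 1"
    unfolding q_def by (rule order_trans[OF degree_prod_sum_le]) (auto intro!: order_trans[OF sum_bounded_above[where K=1]])
  have coeff0: "coeff q 0 = 1" using polyq[of 0] by (simp add: poly_0_coeff_0)
  define \<tau>0 where "\<tau>0 k = - coeff q (k + 1)" for k
  have q_eq: "poly q s = 1 - (\<Sum>k\<le>K. \<tau>0 k * s ^ (k + 1))" for s
  proof -
    have "poly q s = (\<Sum>i\<le>Suc K. coeff q i * s ^ i)"
      unfolding poly_altdef
      by (intro sum.mono_neutral_left) (use degq in \<open>auto simp: coeff_eq_0\<close>)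
    also have "\<dots> = 1 - (\<Sum>k\<le>K. \<tau>0 k * s ^ (k + 1))"
      by (subst sum.atMost_Suc_shift) (simp add: coeff0 \<tau>0_def sum_negf)
    finally show ?thesis .
  qed
  \<comment> \<open>Both ends of bracket \<open>j\<close> lie on the same side of every node except
    \<open>z0 j\<close>, which they enclose; so only the factor of index \<open>j\<close> is
    negative.\<close>
  have sgn: "poly q (lo j) * poly q (hi j) < 0" if "j \<le> K" for j
  proof -
    let ?f = "\<lambda>i. (1 - lo j / z0 i) * (1 - hi j / z0 i)"
    have f: "?f i = ((real i + 1) - (real j + 3/4)) * ((real i + 1) - (real j + 5/4)) / (real i + 1)^2" for i
    proof -
      have "lo j / z0 i = (real j + 3/4) / (real i + 1)" "hi j / z0 i = (real j + 5/4) / (real i + 1)"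
        unfolding lo_def hi_def z0_def using w(1) by simp_all
      moreover have "1 - x / (real i + 1) = ((real i + 1) - x) / (real i + 1)" for x
        by (simp add: field_simps)
      ultimately show ?thesis by (simp only: times_divide_times_eq power2_eq_square)
    qed
    have "poly q (lo j) * poly q (hi j) = (\<Prod>i\<le>K. ?f i)" by (simp add: polyq prod.distrib)
    also have "\<dots> = ?f j * (\<Prod>i\<in>{..K}-{j}. ?f i)" using that by (intro prod.remove) auto
    also have "\<dots> < 0"
    proof (rule mult_neg_pos)
      show "?f j < 0" unfolding f by (simp add: divide_neg_pos)
      show "0 < (\<Prod>i\<in>{..K}-{j}. ?f i)"
      proof (rule prod_pos)
        fix i assume i: "i \<in> {..K}-{j}"
        then have "i + 1 \<le> j \<or> j + 1 \<le> i" by auto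
        then have "real i + 1 \<le> real j \<or> real j + 1 \<le> real i" by linarith
        then have "0 < ((real i + 1) - (real j + 3/4)) * ((real i + 1) - (real j + 5/4))"
          by (auto simp: zero_less_mult_iff)
        then show "0 < ?f i" unfolding f by (intro divide_pos_pos) auto
      qed
    qed
    finally show ?thesis .
  qed
  \<comment> \<open>The margin by which \<open>q\<close> avoids 0 at the ends of all brackets; a
    smaller perturbation cannot change the signs there.\<close>
  define m where "m = Min ((\<lambda>j. min \<bar>poly q (lo j)\<bar> \<bar>poly q (hi j)\<bar>) ` {..K})"
  have m: "m \<le> \<bar>poly q (lo j)\<bar>" "m \<le> \<bar>poly q (hi j)\<bar>" if "j \<le> K" for j
  proof -
    have "m \<le> min \<bar>poly q (lo j)\<bar> \<bar>poly q (hi j)\<bar>" unfolding m_def using that by (intro Min_le) auto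
    then show "m \<le> \<bar>poly q (lo j)\<bar>" "m \<le> \<bar>poly q (hi j)\<bar>" by auto
  qed
  have m0: "0 < m" unfolding m_def using sgn by (subst Min_gr_iff) (fastforce simp: mult_less_0_iff)+
  define S where "S = (\<Sum>k\<le>K. \<bar>\<tau>0 k\<bar>)"
  have S: "0 \<le> S" by (simp add: S_def sum_nonneg)
  \<comment> \<open>\<open>\<kappa> * \<eta>\<close> will bound the distance of the perturbed curve
    from the monomial one, and \<open>\<kappa>2 * \<eta>\<close> the resulting change of the level
    function.\<close>
  define \<kappa> where "\<kappa> = 8 * (real K + 1)"
  define \<kappa>2 where "\<kappa>2 = real K + 1 + S * \<kappa>"
  have \<kappa>: "0 < \<kappa>" "0 < \<kappa>2" using S by (auto simp: \<kappa>_def \<kappa>2_def add_pos_nonneg)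
  have w2: "0 < w / 2" using w by simp
  obtain B where B: "0 < B" "\<And>z p e k. \<forall>i<K+2. \<bar>z i\<bar> \<le> 1 \<Longrightarrow> \<forall>i<K+2. \<forall>j<K+2. i \<noteq> j \<longrightarrow> w / 2 \<le> \<bar>z i - z j\<bar> \<Longrightarrow>
    degree p < K+2 \<Longrightarrow> \<forall>i<K+2. \<bar>poly p (z i)\<bar> \<le> e \<Longrightarrow> \<bar>coeff p k\<bar> \<le> B * (e::real)"
    using coeff_le_of_separated_values[OF w2, of "K+2"] by blast
  \<comment> \<open>The three bounds keep the row sums below 2, the level function within the margin
    \<open>m\<close>, and the factor in the final Vandermonde estimate below 1.\<close>
  define \<eta> where "\<eta> = Min {1 / (real K + 1), m / (2 * \<kappa>2), 1 / (2 * (B * (real K + 1) * \<kappa>))}"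
  have \<eta>: "0 < \<eta>" "\<eta> \<le> 1 / (real K + 1)" "\<eta> \<le> m / (2 * \<kappa>2)" "\<eta> \<le> 1 / (2 * (B * (real K + 1) * \<kappa>))"
    using m0 \<kappa> B(1) by (auto simp: \<eta>_def)
  have \<eta>1: "(real K + 1) * \<eta> \<le> 1" using \<eta>(2) by (simp add: field_simps)
  have \<eta>2: "\<kappa>2 * \<eta> < m" using \<eta>(3) \<kappa> m0 by (simp add: field_simps)
  have \<eta>3: "B * (real K + 1) * \<kappa> * \<eta> < 1"
  proof -
    define Y where "Y = B * (real K + 1) * \<kappa>"
    have "0 < Y" using \<kappa> B(1) by (simp add: Y_def)
    moreover have "\<eta> \<le> 1 / (2 * Y)" using \<eta>(4) by (simp add: Y_def)
    ultimately have "Y * \<eta> < 1" by (simp add: field_simps)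
    then show ?thesis by (simp only: Y_def)
  qed
  have "v k = 0" if
      UV: "\<forall>k\<le>K. \<forall>k'\<le>K. \<bar>U k k' - monU M k k'\<bar> \<le> \<eta> \<and> \<bar>V k k' - monV M k k'\<bar> \<le> \<eta>"
      and \<tau>: "\<forall>k\<le>K. \<bar>\<tau> k - \<tau>0 k\<bar> \<le> \<eta>"
      and v: "\<forall>c. (\<forall>k\<le>K. k \<noteq> 0 \<longrightarrow> c k = (\<Sum>k'\<le>K. U k k' * c k') * (\<Sum>k'\<le>K. V k k' * c k')) \<longrightarrow>
        (\<Sum>k\<le>K. \<tau> k * c k) = 1 \<longrightarrow> (\<Sum>k\<le>K. v k * c k) = 0" and k: "k \<le> K"
    for U V :: "nat \<Rightarrow> nat \<Rightarrow> real" and \<tau> v k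
  proof -
    have row: "(\<Sum>k'\<le>K. \<bar>W k'\<bar>) \<le> 2" if "\<And>k'. k' \<le> K \<Longrightarrow> \<bar>W k' - W' k'\<bar> \<le> \<eta>" "(\<Sum>k'\<le>K. \<bar>W' k'\<bar>) \<le> 1"
      for W W' :: "nat \<Rightarrow> real"
    proof -
      have "(\<Sum>k'\<le>K. \<bar>W k'\<bar>) \<le> (\<Sum>k'\<le>K. \<bar>W' k'\<bar> + \<eta>)"
        using that(1) by (intro sum_mono) force
      then show ?thesis using that(2) \<eta>1 by (simp add: sum.distrib algebra_simps)
    qed
    have mon_row: "(\<Sum>k'\<le>K. \<bar>monU M k k'\<bar>) = 1" "(\<Sum>k'\<le>K. \<bar>monV M k k'\<bar>) = 1" if "k \<le> K" for k
      using mon_sum[OF that, of M "\<lambda>_. 1"]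
      by (simp_all add: monU_def monV_def if_distrib[of abs] cong: if_cong)
    interpret c: curve K U V 2
      using UV mon_row row by unfold_locales (metis order_refl)+
    interpret c0: curve K "monU M" "monV M" 2
      by unfold_locales (simp_all add: mon_row)
    have "\<exists>c. curve_pt K U V s c" if "0 \<le> s" "s \<le> 1/16" for s
      using c.curve_pt_exists[of s] that by simp
    then obtain c where c: "\<And>s. 0 \<le> s \<Longrightarrow> s \<le> 1/16 \<Longrightarrow> curve_pt K U V s (c s)" by metis
    have ceq: "c s k = step K U V s (c s) k" "\<bar>c s k\<bar> \<le> s" if "0 \<le> s" "s \<le> 1/16" "k \<le> K" for s k
      using c[OF that(1,2)] that(3) unfolding curve_pt_def by auto
    have near: "\<bar>c s k - s ^ (k + 1)\<bar> \<le> \<kappa> * \<eta>" if s: "0 \<le> s" "s \<le> 1/16" "k \<le> K" for s k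
    proof -
      have mon: "\<bar>s ^ (k + 1)\<bar> \<le> s" if "k \<le> K" for k
      proof -
        have "curve_pt K (monU M) (monV M) s (\<lambda>k. s ^ (k + 1))" using s by (intro curve_pt_mon) auto
        then show ?thesis using that unfolding curve_pt_def by blast
      qed
      have "\<bar>s ^ (k + 1) - step K U V s (\<lambda>k. s ^ (k + 1)) k\<bar> \<le> 4 * (real K + 1) * \<eta>" if "k \<le> K" for k
      proof -
        have "\<bar>step K (monU M) (monV M) s (\<lambda>k. s ^ (k + 1)) k - step K U V s (\<lambda>k. s ^ (k + 1)) k\<bar>
            \<le> 2 * 2 * s * ((real K + 1) * \<eta> * s)"
          using UV mon \<eta>(1) that
          by (intro step_perturb[OF c0.curve_axioms c.curve_axioms]) (auto simp: abs_minus_commute)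
        also have "\<dots> = 4 * (real K + 1) * \<eta> * (s * s)" by (simp add: algebra_simps)
        also have "\<dots> \<le> 4 * (real K + 1) * \<eta> * 1"
          using s \<eta>(1) by (intro mult_left_mono mult_le_one) auto
        finally show ?thesis by (simp only: step_mon[OF that] mult_1_right)
      qed
      then have "\<bar>c s k - s ^ (k + 1)\<bar> \<le> \<bar>s - s\<bar> + 2 * (4 * (real K + 1) * \<eta>)"
        using ceq s mon by (intro c.curve_pt_stable[where \<rho>=s]) auto
      then show ?thesis by (simp add: \<kappa>_def algebra_simps)
    qed
    \<comment> \<open>The level function along the perturbed curve; for the unperturbed data it is
      \<open>1 - q\<close>, so points with \<open>h z = 1\<close> continue the zeros of
      \<open>q\<close>.\<close>
    define h where "h s = (\<Sum>k\<le>K. \<tau> k * c s k)" for s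
    have hq: "\<bar>h s - (1 - poly q s)\<bar> < m" if s: "0 \<le> s" "s \<le> 1/16" for s
    proof -
      have "h s - (1 - poly q s) = (\<Sum>k\<le>K. (\<tau> k - \<tau>0 k) * c s k + \<tau>0 k * (c s k - s ^ (k + 1)))"
        by (simp add: h_def q_eq sum_subtractf sum.distrib algebra_simps)
      also have "\<bar>\<dots>\<bar> \<le> (\<Sum>k\<le>K. \<eta> * 1 + \<bar>\<tau>0 k\<bar> * (\<kappa> * \<eta>))"
      proof (intro order_trans[OF sum_abs] sum_mono order_trans[OF abs_triangle_ineq] add_mono; unfold abs_mult)
        fix k assume "k \<in> {..K}"
        then have k: "k \<le> K" by simp
        show "\<bar>\<tau> k - \<tau>0 k\<bar> * \<bar>c s k\<bar> \<le> \<eta> * 1"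
          using \<tau> k ceq(2)[OF s k] s \<eta>(1) by (intro mult_mono) auto
        show "\<bar>\<tau>0 k\<bar> * \<bar>c s k - s ^ (k + 1)\<bar> \<le> \<bar>\<tau>0 k\<bar> * (\<kappa> * \<eta>)"
          using near[OF s k] by (intro mult_left_mono) auto
      qed
      also have "\<dots> = \<kappa>2 * \<eta>"
        by (simp add: sum.distrib S_def \<kappa>2_def sum_distrib_right distrib_right mult.assoc)
      finally show ?thesis using \<eta>2 by simp
    qed
    have cont: "continuous_on {0..1/16} (\<lambda>s. c s k)" if "k \<le> K" for k
    proof (rule continuous_on_iff[THEN iffD2], intro ballI allI impI)
      fix s e :: real assume s: "s \<in> {0..1/16}" and "0 < e"
      have "\<bar>c s' k - c s k\<bar> \<le> \<bar>s' - s\<bar> + 2 * 0" if "s' \<in> {0..1/16}" for s'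
      proof (rule c.curve_pt_stable[where \<rho>="1/16"])
        fix i assume i: "i \<le> K"
        show "c s' i = step K U V s' (c s') i" using that i by (intro ceq) auto
        show "\<bar>c s i - step K U V s (c s) i\<bar> \<le> 0" using ceq(1)[of s i] s i by auto
        show "\<bar>c s' i\<bar> \<le> 1/16" using ceq(2)[of s' i] that i by auto
        show "\<bar>c s i\<bar> \<le> 1/16" using ceq(2)[of s i] s i by auto
      qed (use \<open>k \<le> K\<close> in auto)
      then show "\<exists>d>0. \<forall>x'\<in>{0..1/16}. dist x' s < d \<longrightarrow> dist (c x' k) (c s k) < e"
        using \<open>0 < e\<close> by (intro exI[of _ e]) (force simp: dist_real_def)
    qed
    have "\<exists>z. lo j \<le> z \<and> z \<le> hi j \<and> h z = 1" if j: "j \<le> K" for j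
    proof -
      have b: "0 \<le> lo j" "lo j \<le> 1/16" "0 \<le> hi j" "hi j \<le> 1/16" using lohi[of j] hi1[OF j] by auto
      have h: "continuous_on {lo j..hi j} h"
        unfolding h_def by (intro continuous_intros continuous_on_subset[OF cont]) (use b in auto)
      have 1: "\<bar>h (lo j) - 1 + poly q (lo j)\<bar> < \<bar>poly q (lo j)\<bar>" using hq[OF b(1,2)] m(1)[OF j] by linarith
      have 2: "\<bar>h (hi j) - 1 + poly q (hi j)\<bar> < \<bar>poly q (hi j)\<bar>" using hq[OF b(3,4)] m(2)[OF j] by linarith
      consider "poly q (lo j) < 0" "0 < poly q (hi j)" | "0 < poly q (lo j)" "poly q (hi j) < 0"
        using sgn[OF j] by (auto simp: mult_less_0_iff)
      then show ?thesis
      proof cases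
        case 1
        then show ?thesis using \<open>\<bar>h (lo j) - 1 + poly q (lo j)\<bar> < \<bar>poly q (lo j)\<bar>\<close> 2 lohi(2)[of j] h
          by (intro IVT2') auto
      next
        case 2
        then show ?thesis using 1 \<open>\<bar>h (hi j) - 1 + poly q (hi j)\<bar> < \<bar>poly q (hi j)\<bar>\<close> lohi(2)[of j] h
          by (intro IVT') auto
      qed
    qed
    then obtain z where z: "\<And>j. j \<le> K \<Longrightarrow> lo j \<le> z j" "\<And>j. j \<le> K \<Longrightarrow> z j \<le> hi j" "\<And>j. j \<le> K \<Longrightarrow> h (z j) = 1"
      by metis
    have zb: "0 \<le> z j" "z j \<le> 1/16" if "j \<le> K" for j
      using z(1,2)[OF that] lohi[of j] hi1[OF that] by auto
    have vz: "(\<Sum>k\<le>K. v k * c (z j) k) = 0" if "j \<le> K" for j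
    proof (rule v[rule_format])
      show "(\<Sum>k\<le>K. \<tau> k * c (z j) k) = 1" using z(3)[OF that] by (simp add: h_def)
      fix k assume "k \<le> K" "k \<noteq> 0"
      then show "c (z j) k = (\<Sum>k'\<le>K. U k k' * c (z j) k') * (\<Sum>k'\<le>K. V k k' * c (z j) k')"
        using ceq(1)[OF zb[OF that], of k] by (simp add: step_def)
    qed
    define L where "L = Max ((\<lambda>k. \<bar>v k\<bar>) ` {..K})"
    have L: "\<bar>v k\<bar> \<le> L" if "k \<le> K" for k unfolding L_def using that by (intro Max_ge) auto
    have "L \<in> (\<lambda>k. \<bar>v k\<bar>) ` {..K}" unfolding L_def by (intro Max_in) auto
    then obtain k0 where k0: "k0 \<le> K" "L = \<bar>v k0\<bar>" by auto
    \<comment> \<open>The form \<open>v\<close> along the monomial curve. At the parameters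
      \<open>z j\<close> it is small, because \<open>v\<close> vanishes exactly on the nearby
      perturbed points.\<close>
    define p where "p = (\<Sum>k\<le>K. Polynomial.monom (v k) (k + 1))"
    have pp: "poly p s = (\<Sum>k\<le>K. v k * s ^ (k + 1))" for s by (simp add: p_def poly_sum poly_monom)
    have coeffp: "coeff p (k + 1) = v k" if "k \<le> K" for k
      using that by (simp add: p_def coeff_sum)
    have degp: "degree p < K + 2"
      unfolding p_def by (rule degree_sum_less) (auto intro: le_less_trans[OF degree_monom_le])
    \<comment> \<open>\<open>p\<close> has degree at most \<open>K + 1\<close>, so
      \<open>K + 2\<close> nodes are required; the additional one is 0, where \<open>p\<close>
      vanishes for lack of a constant term.\<close>
    define zz where "zz i = (if i = 0 then 0 else z (i - 1))" for i
    have zz: "0 \<le> zz i" "zz i \<le> 1/16" "i \<noteq> 0 \<Longrightarrow> w * (real i - 1/4) \<le> zz i" "zz i \<le> w * (real i + 1/4)"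
      if "i < K + 2" for i
    proof -
      have "i \<noteq> 0 \<Longrightarrow> i - 1 \<le> K" using that by simp
      then show "0 \<le> zz i" "zz i \<le> 1/16" "i \<noteq> 0 \<Longrightarrow> w * (real i - 1/4) \<le> zz i" "zz i \<le> w * (real i + 1/4)"
        using zb[of "i-1"] z(1,2)[of "i-1"] w by (auto simp: zz_def lo_def hi_def of_nat_diff algebra_simps)
    qed
    have sep: "w / 2 \<le> zz j - zz i" if "i < j" "j < K + 2" for i j
    proof -
      have "w * (real i + 1/4) + w / 2 = w * (real i + 3/4)" by (simp add: algebra_simps)
      also have "\<dots> \<le> w * (real j - 1/4)" using that w by (intro mult_left_mono) auto
      finally show ?thesis using zz(3)[of j] zz(4)[of i] that by linarith
    qed
    have "\<bar>coeff p (k0 + 1)\<bar> \<le> B * ((real K + 1) * (L * (\<kappa> * \<eta>)))"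
    proof (rule B(2)[of zz])
      show "\<forall>i<K+2. \<bar>zz i\<bar> \<le> 1" using zz by force
      show "\<forall>i<K+2. \<forall>j<K+2. i \<noteq> j \<longrightarrow> w / 2 \<le> \<bar>zz i - zz j\<bar>"
      proof (intro allI impI)
        fix i j assume "i < K + 2" "j < K + 2" "i \<noteq> j"
        then show "w / 2 \<le> \<bar>zz i - zz j\<bar>"
          using sep[of i j] sep[of j i] by (cases "i < j") (auto simp: abs_if)
      qed
      show "degree p < K + 2" by fact
      show "\<forall>i<K+2. \<bar>poly p (zz i)\<bar> \<le> (real K + 1) * (L * (\<kappa> * \<eta>))"
      proof (intro allI impI)
        fix i assume i: "i < K + 2"
        have L0: "0 \<le> L" using k0 by simp
        show "\<bar>poly p (zz i)\<bar> \<le> (real K + 1) * (L * (\<kappa> * \<eta>))"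
        proof (cases "i = 0")
          case True
          then show ?thesis using L0 \<kappa> \<eta>(1) by (simp add: pp zz_def)
        next
          case False
          then have i1: "i - 1 \<le> K" and zzi: "zz i = z (i - 1)" using i by (auto simp: zz_def)
          have "poly p (zz i) = (\<Sum>k\<le>K. v k * (z (i-1) ^ (k + 1) - c (z (i-1)) k))"
            using vz[OF i1] by (simp add: pp zzi right_diff_distrib sum_subtractf)
          also have "\<bar>\<dots>\<bar> \<le> (\<Sum>k\<le>K. L * (\<kappa> * \<eta>))"
            by (rule order_trans[OF sum_abs], rule sum_mono)
              (use near[OF zb[OF i1]] L L0 in \<open>auto simp: abs_mult abs_minus_commute intro!: mult_mono\<close>)
          finally show ?thesis by (simp add: add.commute)
        qed
      qed
    qed
    \<comment> \<open>The largest coefficient is bounded by itself times a factor below 1, hence is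
      0.\<close>
    then have "L \<le> (B * (real K + 1) * \<kappa> * \<eta>) * L" using k0 coeffp[OF k0(1)] by (simp add: mult_ac)
    moreover have "0 \<le> L" using k0 by simp
    ultimately have "L = 0" using \<eta>3
      by (metis less_eq_real_def linorder_not_le mult_less_cancel_right2)
    then show "v k = 0" using L[OF k] by simp
  qed
  then show ?thesis using \<eta>(1) by blast
qed

section \<open>Tensor rank and spans of rank-one matrices\<close>

definition fscale :: "real \<Rightarrow> ('a \<Rightarrow> real) \<Rightarrow> 'a \<Rightarrow> real" where
  "fscale c f = (\<lambda>x. c * f x)"

lemma fscale_apply [simp]: "fscale c f x = c * f x"
  by (simp add: fscale_def)

interpretation funvec: vector_space fscale
  by unfold_locales (auto simp: fun_eq_iff algebra_simps)

interpretation real_vec: vector_space "(*) :: real \<Rightarrow> real \<Rightarrow> real"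
  by unfold_locales (auto simp: algebra_simps)

interpretation funvec_real: vector_space_pair fscale "(*) :: real \<Rightarrow> real \<Rightarrow> real" ..

abbreviation functional :: "(('a \<Rightarrow> real) \<Rightarrow> real) \<Rightarrow> bool" where
  "functional \<equiv> Vector_Spaces.linear fscale (*)"

lemma sum_fun_apply: "(\<Sum>i\<in>A. f i) x = (\<Sum>i\<in>A. f i x :: 'b::comm_monoid_add)"
  by (induction A rule: infinite_finite_induct) auto

text \<open>This is how span membership of a slice becomes a question about linear forms on the
  curve.\<close>

lemma separating_functional:
  assumes "x \<notin> funvec.span R"
  shows "\<exists>g. functional g \<and> (\<forall>y\<in>R. g y = 0) \<and> g x \<noteq> 0"
proof -
  obtain B where B: "B \<subseteq> R" "funvec.independent B" "R \<subseteq> funvec.span B"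
    using funvec.maximal_independent_subset by blast
  have "x \<notin> funvec.span B" using assms funvec.span_mono[OF B(1)] by blast
  then have "funvec.independent (insert x B)" "x \<notin> B"
    using B(2) funvec.span_base[of x B] by (auto simp: funvec.independent_insert)
  then obtain g where g: "functional g" "\<forall>y\<in>insert x B. g y = (if y = x then 1 else 0)"
    using funvec_real.linear_independent_extend[of "insert x B" "\<lambda>y. if y = x then 1 else 0"] by blast
  have "\<forall>y\<in>B. g y = 0" using g(2) \<open>x \<notin> B\<close> by auto
  then have "\<forall>y\<in>R. g y = 0" using funvec_real.linear_eq_0_on_span[OF g(1)] B(3) by blast
  then show ?thesis using g by auto
qed

definition slice :: "nat \<Rightarrow> nat \<Rightarrow> (nat \<times> nat \<times> nat \<Rightarrow> real) \<Rightarrow> nat \<Rightarrow> nat \<times> nat \<Rightarrow> real" where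
  "slice m n T k = (\<lambda>(i, j). if i < m \<and> j < n then T (i, j, k) else 0)"

definition outer :: "nat \<Rightarrow> nat \<Rightarrow> (nat \<Rightarrow> real) \<Rightarrow> (nat \<Rightarrow> real) \<Rightarrow> nat \<times> nat \<Rightarrow> real" where
  "outer m n a b = (\<lambda>(i, j). if i < m \<and> j < n then a i * b j else 0)"

definition outers :: "nat \<Rightarrow> nat \<Rightarrow> (nat \<times> nat \<Rightarrow> real) set" where
  "outers m n = {outer m n a b | a b. True}"

definition corner :: "nat \<Rightarrow> nat \<Rightarrow> nat \<times> nat \<Rightarrow> real" where
  "corner m n = outer m n (\<lambda>i. if i = 0 then 1 else 0) (\<lambda>j. if j = 0 then 1 else 0)"

definition decomposable :: "nat \<Rightarrow> nat \<Rightarrow> nat \<Rightarrow> (nat \<times> nat \<times> nat \<Rightarrow> real) \<Rightarrow> nat \<Rightarrow> bool" where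
  "decomposable m n l T r \<longleftrightarrow> (\<exists>a b c :: nat \<Rightarrow> nat \<Rightarrow> real.
      \<forall>i<m. \<forall>j<n. \<forall>k<l. T (i, j, k) = (\<Sum>s<r. a s i * b s j * c s k))"

lemma tensor_rank_alt: "tensor_rank m n l T = (LEAST r. decomposable m n l T r)"
  by (simp add: tensor_rank_def decomposable_def)

text \<open>A basis of the span can be chosen inside the possibly infinite set \<open>R\<close>,
  hence among rank-one matrices; the finite set \<open>Q\<close> bounds its size by the exchange
  lemma.\<close>

lemma decomposable_if_slices_in_span:
  assumes "\<And>k. k < l \<Longrightarrow> slice m n T k \<in> funvec.span R" "R \<subseteq> outers m n"
    and "finite Q" "R \<subseteq> funvec.span Q"
  shows "\<exists>r\<le>card Q. decomposable m n l T r"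
proof -
  obtain B where B: "B \<subseteq> R" "funvec.independent B" "R \<subseteq> funvec.span B"
    using funvec.maximal_independent_subset by blast
  have fin: "finite B" "card B \<le> card Q"
    using funvec.independent_span_bound[OF assms(3) B(2)] B(1) assms(4) by auto
  have "\<exists>u. slice m n T k = (\<Sum>v\<in>B. fscale (u v) v)" if "k < l" for k
  proof -
    have "funvec.span R \<subseteq> funvec.span B" using B(3) by (rule funvec.span_minimal) (rule funvec.subspace_span)
    then show ?thesis using assms(1)[OF that] funvec.span_finite[OF fin(1)] by auto
  qed
  then obtain u where u: "\<And>k. k < l \<Longrightarrow> slice m n T k = (\<Sum>v\<in>B. fscale (u k v) v)" by metis
  have "\<forall>v\<in>B. \<exists>a b. v = outer m n a b" using B(1) assms(2) by (auto simp: outers_def)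
  then obtain a b where ab: "\<And>v. v \<in> B \<Longrightarrow> v = outer m n (a v) (b v)" by metis
  obtain h where h: "bij_betw h {..<card B} B"
    using ex_bij_betw_nat_finite[OF fin(1)] by (auto simp: atLeast0LessThan)
  have "T (i, j, k) = (\<Sum>s<card B. a (h s) i * b (h s) j * u k (h s))" if "i < m" "j < n" "k < l" for i j k
  proof -
    have "T (i, j, k) = slice m n T k (i, j)" using that by (simp add: slice_def)
    also have "\<dots> = (\<Sum>v\<in>B. u k v * v (i, j))" using that by (simp add: u sum_fun_apply)
    also have "\<dots> = (\<Sum>v\<in>B. a v i * b v j * u k v)"
    proof (rule sum.cong)
      fix v assume "v \<in> B"
      from fun_cong[OF ab[OF this], of "(i, j)"] have "v (i, j) = a v i * b v j"
        using that by (simp add: outer_def)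
      then show "u k v * v (i, j) = a v i * b v j * u k v" by simp
    qed simp
    also have "\<dots> = (\<Sum>s<card B. a (h s) i * b (h s) j * u k (h s))"
      by (rule sum.reindex_bij_betw[OF h, symmetric])
    finally show ?thesis .
  qed
  then have "decomposable m n l T (card B)"
    unfolding decomposable_def
    by (intro exI[of _ "\<lambda>s. a (h s)"] exI[of _ "\<lambda>s. b (h s)"] exI[of _ "\<lambda>s k. u k (h s)"]) auto
  then show ?thesis using fin(2) by blast
qed

lemma tensor_rank_le_card:
  assumes "\<And>k. k < l \<Longrightarrow> slice m n T k \<in> funvec.span R" "R \<subseteq> outers m n"
    and "finite Q" "R \<subseteq> funvec.span Q"
  shows "tensor_rank m n l T \<le> card Q"
proof -
  obtain r where "r \<le> card Q" "decomposable m n l T r"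
    using decomposable_if_slices_in_span[OF assms] by blast
  then show ?thesis unfolding tensor_rank_alt by (meson Least_le order_trans)
qed

text \<open>The matrix units give some decomposition, so the \<open>LEAST\<close> in the rank is
  attained.\<close>

lemma decomposable_tensor_rank: "decomposable m n l T (tensor_rank m n l T)"
proof -
  let ?e = "\<lambda>(i, j). outer m n (\<lambda>a. if a = i then 1 else 0) (\<lambda>b. if b = j then 1 else 0)"
  let ?Q = "?e ` ({..<m} \<times> {..<n})"
  have "slice m n T k \<in> funvec.span ?Q" for k
  proof -
    have "slice m n T k = (\<Sum>p\<in>{..<m} \<times> {..<n}. fscale (slice m n T k p) (?e p))"
    proof
      fix x
      have "(\<Sum>p\<in>{..<m} \<times> {..<n}. slice m n T k p * ?e p x) =
          (\<Sum>p\<in>{..<m} \<times> {..<n}. if p = x then slice m n T k p else 0)"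
        by (intro sum.cong refl) (auto simp: outer_def split: prod.splits)
      also have "\<dots> = slice m n T k x" by (auto simp: slice_def split: prod.splits)
      finally show "slice m n T k x = (\<Sum>p\<in>{..<m} \<times> {..<n}. fscale (slice m n T k p) (?e p)) x"
        by (simp add: sum_fun_apply)
    qed
    also have "\<dots> \<in> funvec.span ?Q"
      by (intro funvec.span_sum funvec.span_scale funvec.span_base) auto
    finally show ?thesis .
  qed
  moreover have "?Q \<subseteq> outers m n" by (auto simp: outers_def)
  ultimately have "\<exists>r. decomposable m n l T r"
    using decomposable_if_slices_in_span[of l m n T ?Q ?Q] funvec.span_superset[of ?Q] by auto
  then show ?thesis unfolding tensor_rank_alt by (rule LeastI_ex)
qed

lemma decomposable_mono:
  assumes "decomposable m n l T r" "r \<le> r'"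
  shows "decomposable m n l T r'"
proof -
  obtain a b c :: "nat \<Rightarrow> nat \<Rightarrow> real" where *: "\<forall>i<m. \<forall>j<n. \<forall>k<l. T (i, j, k) = (\<Sum>s<r. a s i * b s j * c s k)"
    using assms(1) unfolding decomposable_def by blast
  have "(\<Sum>s<r. a s i * b s j * c s k) = (\<Sum>s<r'. (if s < r then a s i else 0) * b s j * c s k)" for i j k
    using assms(2) by (intro sum.mono_neutral_cong_left) auto
  then show ?thesis unfolding decomposable_def using *
    by (intro exI[of _ "\<lambda>s i. if s < r then a s i else 0"] exI[of _ b] exI[of _ c]) simp
qed

lemma tensor_rank_le_iff: "tensor_rank m n l T \<le> r \<longleftrightarrow> decomposable m n l T r"
proof
  show "decomposable m n l T r" if "tensor_rank m n l T \<le> r"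
    using decomposable_tensor_rank that by (rule decomposable_mono)
  show "tensor_rank m n l T \<le> r" if "decomposable m n l T r"
    unfolding tensor_rank_alt using that by (rule Least_le)
qed

lemma div_mod_bounds:
  assumes "p < l" "l \<le> m * (n::nat)"
  shows "p mod m < m" "p div m < n"
proof -
  have "p < m * n" using assms by simp
  then show "p mod m < m" "p div m < n"
    by (cases "m = 0"; simp add: less_mult_imp_div_less mult.commute)+
qed

text \<open>The determinant is an \<open>l\<close> by \<open>l\<close> minor of the flattening whose
  columns are the slices; a decomposition with fewer than \<open>l\<close> terms would factor it
  through a smaller dimension.\<close>

lemma tensor_rank_ge:
  assumes "ndet l (\<lambda>p k. T (p mod m, p div m, k)) \<noteq> 0" "l \<le> m * n"
  shows "l \<le> tensor_rank m n l T"
proof (rule ccontr)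
  assume "\<not> l \<le> tensor_rank m n l T"
  moreover obtain a b c :: "nat \<Rightarrow> nat \<Rightarrow> real" where *: "\<forall>i<m. \<forall>j<n. \<forall>k<l.
      T (i, j, k) = (\<Sum>s<tensor_rank m n l T. a s i * b s j * c s k)"
    using decomposable_tensor_rank unfolding decomposable_def by blast
  ultimately have "ndet l (\<lambda>p k. T (p mod m, p div m, k)) = 0"
    by (intro ndet_low_rank[where g="\<lambda>p s. a s (p mod m) * b s (p div m)" and h=c and r="tensor_rank m n l T"])
      (use assms(2) in \<open>auto simp: div_mod_bounds\<close>)
  then show False using assms(1) by simp
qed

lemma finite_tensor_index: "finite (tensor_index m n l)"
  by (simp add: tensor_index_def)

lemma AE_tensor_rank_ge:
  assumes "l \<le> m * n"
  shows "AE T in gaussian_tensor m n l. l \<le> tensor_rank m n l T"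
proof -
  let ?I = "tensor_index m n l"
  have "AE T in PiM ?I (\<lambda>_. gauss). ndet l (\<lambda>p k. T (p mod m, p div m, k)) \<noteq> 0"
  proof (rule AE_polyfun_nonzero)
    show "finite ?I" by (rule finite_tensor_index)
    show "(\<lambda>T. ndet l (\<lambda>p k. T (p mod m, p div m, k))) \<in> polyfun ?I"
      by (intro polyfun_ndet polyfun.coord) (use assms in \<open>auto simp: tensor_index_def div_mod_bounds\<close>)
    have "ndet l (\<lambda>p k. (\<lambda>(i, j, k). if k = i + j * m then 1 else 0 :: real) (p mod m, p div m, k)) = 1"
      by (rule ndet_id) auto
    then show "ndet l (\<lambda>p k. (\<lambda>(i, j, k). if k = i + j * m then 1 else 0 :: real) (p mod m, p div m, k)) \<noteq> 0"
      by simp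
  qed
  then show ?thesis unfolding gaussian_tensor_def
    by eventually_elim (rule tensor_rank_ge[OF _ assms])
qed

lemma compact_bounded_functions: "compact {f :: 'a \<Rightarrow> real. \<forall>i. \<bar>f i\<bar> \<le> q}"
proof -
  have "compactin (product_topology (\<lambda>_::'a. euclidean) UNIV) (PiE UNIV (\<lambda>_. {- q..q}))"
    by (subst compactin_PiE) (simp add: compactin_euclidean_iff)
  moreover have "PiE UNIV (\<lambda>_::'a. {- q..q}) = {f. \<forall>i. \<bar>f i\<bar> \<le> q}"
    by (auto simp: PiE_UNIV_domain abs_le_iff minus_le_iff)
  ultimately show ?thesis by (simp add: euclidean_product_topology flip: compactin_euclidean_iff)
qed

text \<open>Tensors of rank at most \<open>r\<close> are the continuous image of a countable union
  of compact sets of parameters, hence Borel. Since \<open>measure\<close> is 0 on nonmeasurable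
  sets, this is what lets measure 0 be read as a null set.\<close>

lemma measurable_tensor_rank:
  "{T \<in> space (gaussian_tensor m n l). tensor_rank m n l T = r} \<in> sets (gaussian_tensor m n l)"
proof -
  let ?I = "tensor_index m n l"
  let ?M = "gaussian_tensor m n l"
  have sp: "space ?M = (\<Pi>\<^sub>E i\<in>?I. UNIV)" by (simp add: gaussian_tensor_def space_PiM)
  define F :: "nat \<Rightarrow> (nat \<times> nat \<times> nat \<Rightarrow> real) \<Rightarrow> (nat \<times> nat \<times> nat \<Rightarrow> real)" where
    "F r p = (\<lambda>(i, j, k). if (i, j, k) \<in> ?I then \<Sum>s<r. p (0, s, i) * p (1, s, j) * p (2, s, k) else undefined)" for r p
  have contF: "continuous_on UNIV (F r)" for r
  proof (rule continuous_on_coordinatewise_then_product)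
    fix x :: "nat \<times> nat \<times> nat"
    obtain i j k where x: "x = (i, j, k)" by (cases x)
    show "continuous_on UNIV (\<lambda>p. F r p x)"
      unfolding F_def x by (cases "(i, j, k) \<in> ?I") (auto intro!: continuous_intros)
  qed
  have le: "{T \<in> space ?M. tensor_rank m n l T \<le> r} \<in> sets ?M" for r
  proof -
    \<comment> \<open>The compact images live in the full function space, whereas the Gaussian
      measure lives on functions that are \<open>undefined\<close> outside the index box; this map
      transfers measurability.\<close>
    have id: "(\<lambda>T. T) \<in> measurable ?M (PiM UNIV (\<lambda>_. borel))"
    proof (rule measurable_PiM_single')
      fix x :: "nat \<times> nat \<times> nat"
      show "(\<lambda>T. T x) \<in> borel_measurable ?M"
      proof (cases "x \<in> ?I")
        case True
        then have "(\<lambda>T. T x) \<in> measurable ?M gauss"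
          unfolding gaussian_tensor_def by (rule measurable_component_singleton)
        then show ?thesis by (simp add: measurable_def)
      next
        case False
        have "(\<lambda>T. T x) \<in> borel_measurable ?M \<longleftrightarrow> (\<lambda>T. undefined :: real) \<in> borel_measurable ?M"
          using False by (intro measurable_cong) (auto simp: sp)
        then show ?thesis by simp
      qed
    qed (auto simp: PiE_UNIV_domain)
    have "compact (F r ` {p. \<forall>i. \<bar>p i\<bar> \<le> real q})" for q
      by (intro compact_continuous_image compact_bounded_functions continuous_on_subset[OF contF]) auto
    then have "(\<Union>q. F r ` {p. \<forall>i. \<bar>p i\<bar> \<le> real q}) \<in> sets borel"
      by (intro sets.countable_UN) (auto intro: borel_compact)
    then have "(\<lambda>T. T) -` (\<Union>q. F r ` {p. \<forall>i. \<bar>p i\<bar> \<le> real q}) \<inter> space ?M \<in> sets ?M"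
      by (intro measurable_sets[OF id]) (simp only: sets_PiM_equal_borel)
    also have "(\<lambda>T. T) -` (\<Union>q. F r ` {p. \<forall>i. \<bar>p i\<bar> \<le> real q}) \<inter> space ?M =
        {T \<in> space ?M. tensor_rank m n l T \<le> r}"
    proof (intro equalityI subsetI)
      fix T assume "T \<in> (\<lambda>T. T) -` (\<Union>q. F r ` {p. \<forall>i. \<bar>p i\<bar> \<le> real q}) \<inter> space ?M"
      then obtain p where p: "T = F r p" and T: "T \<in> space ?M" by auto
      have "decomposable m n l T r"
        unfolding decomposable_def
        by (rule exI[of _ "\<lambda>s i. p (0, s, i)"], rule exI[of _ "\<lambda>s i. p (1, s, i)"],
            rule exI[of _ "\<lambda>s i. p (2, s, i)"]) (simp add: p F_def tensor_index_def)
      then show "T \<in> {T \<in> space ?M. tensor_rank m n l T \<le> r}"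
        using T by (simp add: tensor_rank_le_iff)
    next
      fix T assume "T \<in> {T \<in> space ?M. tensor_rank m n l T \<le> r}"
      then have T: "T \<in> space ?M" and "decomposable m n l T r" by (auto simp: tensor_rank_le_iff)
      then obtain a b c :: "nat \<Rightarrow> nat \<Rightarrow> real" where
        *: "\<forall>i<m. \<forall>j<n. \<forall>k<l. T (i, j, k) = (\<Sum>s<r. a s i * b s j * c s k)"
        unfolding decomposable_def by blast
      \<comment> \<open>The first index selects the factor. Setting all but finitely many parameters
        to 0 makes them bounded, so that they lie in one of the compact sets.\<close>
      define p where "p = (\<lambda>(t::nat, s, i). if s < r \<and> i < m + n + l then
        (if t = 0 then a s i else if t = 1 then b s i else if t = 2 then c s i else 0) else 0)"
      have "finite (p ` ({..<3} \<times> {..<r} \<times> {..<m + n + l}))" by simp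
      then obtain q0 where q0: "\<forall>x\<in>p ` ({..<3} \<times> {..<r} \<times> {..<m + n + l}). norm x \<le> q0"
        using finite_imp_bounded bounded_iff by metis
      obtain q :: nat where q: "max q0 0 \<le> real q" using real_arch_simple by blast
      have "\<bar>p x\<bar> \<le> real q" for x
      proof (cases "x \<in> {..<3} \<times> {..<r} \<times> {..<m + n + l}")
        case True
        then show ?thesis using q0 q by force
      next
        case False
        then have "p x = 0" by (auto simp: p_def split: prod.splits)
        then show ?thesis by simp
      qed
      moreover have "T = F r p"
      proof
        fix x :: "nat \<times> nat \<times> nat"
        obtain i j k where x: "x = (i, j, k)" by (cases x)
        show "T x = F r p x"
        proof (cases "x \<in> ?I")
          case True
          then show ?thesis using * unfolding x F_def p_def tensor_index_def by (auto intro!: sum.cong)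
        next
          case False
          then show ?thesis using T unfolding sp x F_def by (auto simp: PiE_def extensional_def)
        qed
      qed
      ultimately show "T \<in> (\<lambda>T. T) -` (\<Union>q. F r ` {p. \<forall>i. \<bar>p i\<bar> \<le> real q}) \<inter> space ?M"
        using T by blast
    qed
    finally show ?thesis .
  qed
  have "{T \<in> space ?M. tensor_rank m n l T = r} =
      {T \<in> space ?M. tensor_rank m n l T \<le> r} - (\<Union>r'\<in>{..<r}. {T \<in> space ?M. tensor_rank m n l T \<le> r'})"
  proof -
    have "t = r \<longleftrightarrow> t \<le> r \<and> \<not> (\<exists>r'<r. t \<le> r')" for t
      by (metis le_neq_implies_less linorder_not_less order_refl)
    then show ?thesis by blast
  qed
  also have "\<dots> \<in> sets ?M" using le by (intro sets.Diff sets.finite_UN) auto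
  finally show ?thesis .
qed

section \<open>Rank-one matrices in the span of the slices\<close>

text \<open>Numbers the entries outside row 0 and column 0 by \<open>1, ..., K\<close>, column by
  column; index 0 is left for the curve parameter. By truncated subtraction index 0 also yields the
  valid entry (1, 1).\<close>

definition brow :: "nat \<Rightarrow> nat \<Rightarrow> nat" where "brow m k = (k - 1) mod (m - 1) + 1"
definition bcol :: "nat \<Rightarrow> nat \<Rightarrow> nat" where "bcol m k = (k - 1) div (m - 1) + 1"

text \<open>A subtensor consists of the \<open>K + 1 = (m - 1) * (n - 1) + 1\<close> slices \<open>\<sigma> 0, \<dots>, \<sigma> K\<close>. Row \<open>k \<ge> 1\<close>
  of its block matrix belongs to the entry \<open>(brow m k, bcol m k)\<close> of the slices, and row \<open>0\<close> reads off
  the coefficient of slice \<open>\<sigma> 0\<close>. Changing coordinates by the adjugate instead of the inverse of the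
  block matrix keeps everything polynomial in \<open>T\<close>.\<close>

locale subtensor =
  fixes m n K :: nat and \<sigma> :: "nat \<Rightarrow> nat"
  assumes m: "2 \<le> m" and n: "2 \<le> n" and K: "K = (m - 1) * (n - 1)"
begin

definition block :: "(nat \<times> nat \<times> nat \<Rightarrow> real) \<Rightarrow> nat \<Rightarrow> nat \<Rightarrow> real" where
  "block T k k' = (if k = 0 then if k' = 0 then 1 else 0 else T (brow m k, bcol m k, \<sigma> k'))"

definition block_det :: "(nat \<times> nat \<times> nat \<Rightarrow> real) \<Rightarrow> real" where
  "block_det T = ndet (Suc K) (block T)"

text \<open>The coefficients of entry \<open>(i, j)\<close> of a combination of the slices as a
  linear form in the new coordinates \<open>c\<close>, see \<open>entries_lift\<close>.\<close>

definition red :: "(nat \<times> nat \<times> nat \<Rightarrow> real) \<Rightarrow> nat \<Rightarrow> nat \<Rightarrow> nat \<Rightarrow> real" where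
  "red T i j k = (\<Sum>k'\<le>K. T (i, j, \<sigma> k') * adj (Suc K) (block T) k' k)"

abbreviation "redU T k \<equiv> red T (brow m k) 0"
abbreviation "redV T k \<equiv> red T 0 (bcol m k)"

definition lift :: "(nat \<times> nat \<times> nat \<Rightarrow> real) \<Rightarrow> (nat \<Rightarrow> real) \<Rightarrow> nat \<Rightarrow> real" where
  "lift T c k = (\<Sum>k'\<le>K. adj (Suc K) (block T) k k' * c k')"

lemma K_pos: "0 < K"
  using m n by (simp add: K)

lemma brow_bcol_bounds:
  assumes "k \<le> K"
  shows "0 < brow m k" "brow m k < m" "0 < bcol m k" "bcol m k < n"
proof -
  have "k - 1 < (m - 1) * (n - 1)" unfolding K[symmetric] using assms K_pos by linarith
  from div_mod_bounds[OF this order_refl] m n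
  show "0 < brow m k" "brow m k < m" "0 < bcol m k" "bcol m k < n"
    unfolding brow_def bcol_def by linarith+
qed

lemma brow_bcol_surj:
  assumes "0 < i" "i < m" "0 < j" "j < n"
  obtains k where "k \<noteq> 0" "k \<le> K" "brow m k = i" "bcol m k = j"
proof
  let ?k = "Suc ((i - 1) + (j - 1) * (m - 1))"
  have "(i - 1) + (j - 1) * (m - 1) < (m - 1) + (j - 1) * (m - 1)" using assms by auto
  also have "\<dots> = j * (m - 1)" using assms(3) by (cases j) auto
  also have "\<dots> \<le> (n - 1) * (m - 1)" using assms(4) by (intro mult_right_mono) auto
  finally show "?k \<le> K" by (simp add: K mult.commute)
  have "(a + b * c) mod c = a" "(a + b * c) div c = b" if "a < c" for a b c :: nat
    using that by auto
  from this[of "i - 1" "m - 1" "j - 1"] assms(1-3)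
  show "brow m ?k = i" "bcol m ?k = j" unfolding brow_def bcol_def diff_Suc_1 by linarith+
qed simp

lemma entries_lift: "(\<Sum>k\<le>K. T (i, j, \<sigma> k) * lift T c k) = (\<Sum>k\<le>K. red T i j k * c k)"
  unfolding lift_def red_def sum_distrib_left sum_distrib_right
  by (subst sum.swap) (simp add: mult.assoc)

lemma red_block:
  assumes "k \<le> K" "k \<noteq> 0" "k' \<le> K"
  shows "red T (brow m k) (bcol m k) k' = (if k = k' then block_det T else 0)"
  using ndet_adj(1)[of k "Suc K" k' "block T"] assms
  by (simp add: red_def block_def block_det_def lessThan_Suc_atMost)

text \<open>Put \<open>D = block_det T\<close>. The corner term sets the entry (0, 0) to
  \<open>1 / D\<close>, while entry \<open>k\<close> of the block is \<open>D * c k\<close>; their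
  product is \<open>c k\<close>, so the equation for \<open>c k\<close> is the vanishing of a 2 by 2
  minor.\<close>

lemma lift_rank_one:
  assumes "block_det T \<noteq> 0"
    and "\<And>k. k \<le> K \<Longrightarrow> k \<noteq> 0 \<Longrightarrow> c k = (\<Sum>k'\<le>K. redU T k k' * c k') * (\<Sum>k'\<le>K. redV T k k' * c k')"
  defines "a \<equiv> \<lambda>i. if i = 0 then 1 else block_det T * (\<Sum>k\<le>K. red T i 0 k * c k)"
    and "b \<equiv> \<lambda>j. if j = 0 then 1 / block_det T else (\<Sum>k\<le>K. red T 0 j k * c k)"
  shows "(\<Sum>k\<le>K. fscale (lift T c k) (slice m n T (\<sigma> k))) +
      fscale (1 / block_det T - (\<Sum>k\<le>K. red T 0 0 k * c k)) (corner m n) = outer m n a b"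
    (is "?S + ?P = _")
proof
  fix x :: "nat \<times> nat"
  obtain i j where x: "x = (i, j)" by (cases x)
  show "(?S + ?P) x = outer m n a b x"
  proof (cases "i < m \<and> j < n")
    case False
    then show ?thesis by (auto simp: x sum_fun_apply slice_def outer_def corner_def)
  next
    case True
    let ?E = "\<lambda>i j. \<Sum>k\<le>K. red T i j k * c k"
    have "?S x = (\<Sum>k\<le>K. T (i, j, \<sigma> k) * lift T c k)"
      using True by (simp add: x sum_fun_apply slice_def mult.commute)
    also have "\<dots> = ?E i j" by (rule entries_lift)
    finally have S: "?S x = ?E i j" .
    have "?E i j = block_det T * ?E i 0 * ?E 0 j" if ij: "0 < i" "0 < j"
    proof -
      obtain k where k: "k \<noteq> 0" "k \<le> K" "brow m k = i" "bcol m k = j"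
        using brow_bcol_surj ij True by blast
      have "?E i j = (\<Sum>k'\<le>K. (if k = k' then block_det T else 0) * c k')"
        using red_block[OF k(2,1)] by (intro sum.cong) (auto simp: k(3,4))
      also have "\<dots> = block_det T * c k" using k(2) by (simp add: if_distrib[of "\<lambda>x. x * _"] cong: if_cong)
      finally show ?thesis using assms(2)[OF k(2,1)] by (simp add: k(3,4))
    qed
    then show ?thesis using S True assms(1) by (auto simp: x outer_def corner_def a_def b_def)
  qed
qed

text \<open>A functional that kills \<open>R\<close> induces a form \<open>v\<close> on the
  coordinates \<open>c\<close>, which vanishes at all admissible \<open>c\<close> and so is zero;
  multiplying by the block matrix recovers its values on the slices up to the factor
  \<open>block_det T\<close>. The predicate \<open>P\<close> is trivial for the bound
  \<open>l + 1\<close> and the level equation for the bound \<open>l\<close>.\<close>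

lemma slices_in_span:
  assumes det: "block_det T \<noteq> 0"
    and indep: "\<And>v. (\<And>c. (\<And>k. k \<le> K \<Longrightarrow> k \<noteq> 0 \<Longrightarrow>
          c k = (\<Sum>k'\<le>K. redU T k k' * c k') * (\<Sum>k'\<le>K. redV T k k' * c k')) \<Longrightarrow> P c \<Longrightarrow>
        (\<Sum>k\<le>K. v k * c k) = 0) \<Longrightarrow> \<forall>k\<le>K. v k = 0"
    and R: "\<And>c. (\<And>k. k \<le> K \<Longrightarrow> k \<noteq> 0 \<Longrightarrow>
          c k = (\<Sum>k'\<le>K. redU T k k' * c k') * (\<Sum>k'\<le>K. redV T k k' * c k')) \<Longrightarrow> P c \<Longrightarrow>
        (\<Sum>k\<le>K. fscale (lift T c k) (slice m n T (\<sigma> k))) \<in> funvec.span R"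
    and k: "k \<le> K"
  shows "slice m n T (\<sigma> k) \<in> funvec.span R"
proof (rule ccontr)
  assume "slice m n T (\<sigma> k) \<notin> funvec.span R"
  then obtain g where g: "functional g" "\<forall>y\<in>R. g y = 0" "g (slice m n T (\<sigma> k)) \<noteq> 0"
    using separating_functional by blast
  define w where "w k = g (slice m n T (\<sigma> k))" for k
  define v where "v k' = (\<Sum>k\<le>K. w k * adj (Suc K) (block T) k k')" for k'
  have "\<forall>k\<le>K. v k = 0"
  proof (rule indep)
    fix c assume c: "\<And>k. k \<le> K \<Longrightarrow> k \<noteq> 0 \<Longrightarrow>
          c k = (\<Sum>k'\<le>K. redU T k k' * c k') * (\<Sum>k'\<le>K. redV T k k' * c k')" and "P c"
    have "(\<Sum>k\<le>K. v k * c k) = (\<Sum>k\<le>K. w k * lift T c k)"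
      unfolding lift_def v_def sum_distrib_left sum_distrib_right
      by (subst sum.swap) (simp add: mult.assoc)
    also have "\<dots> = g (\<Sum>k\<le>K. fscale (lift T c k) (slice m n T (\<sigma> k)))"
      by (simp add: funvec_real.linear_sum[OF g(1)] funvec_real.linear_scale[OF g(1)] w_def mult.commute)
    also have "\<dots> = 0"
      using funvec_real.linear_eq_0_on_span[OF g(1)] g(2) R[OF c \<open>P c\<close>] by blast
    finally show "(\<Sum>k\<le>K. v k * c k) = 0" .
  qed
  then have v0: "v k' = 0" if "k' < Suc K" for k' using that by simp
  have "block_det T * w k = (\<Sum>i<Suc K. w i * (if i = k then block_det T else 0))"
    using k by (simp add: if_distrib cong: if_cong)
  also have "\<dots> = (\<Sum>i<Suc K. w i * (\<Sum>j<Suc K. adj (Suc K) (block T) i j * block T j k))"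
    using k by (intro sum.cong refl) (simp only: ndet_adj(2) block_det_def lessThan_iff less_Suc_eq_le)
  also have "\<dots> = (\<Sum>j<Suc K. v j * block T j k)"
    unfolding v_def sum_distrib_left sum_distrib_right lessThan_Suc_atMost
    by (subst sum.swap) (simp add: mult.assoc)
  also have "\<dots> = 0" using v0 by simp
  finally show False using g(3) det by (simp add: w_def)
qed

text \<open>The corner is itself one of the rank-one matrices, so subtracting its multiple from the
  matrix of \<open>lift_rank_one\<close> stays in their span.\<close>

lemma slices_in_span_outers:
  assumes "block_det T \<noteq> 0" "jetdet K (redU T) (redV T) \<noteq> 0" "k \<le> K"
    and "\<And>k. k \<le> K \<Longrightarrow> \<sigma> k < l"
  shows "slice m n T (\<sigma> k) \<in> funvec.span (outers m n \<inter> funvec.span (insert (corner m n) (slice m n T ` {..<l})))"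
    (is "_ \<in> funvec.span ?R")
proof (rule slices_in_span[where P="\<lambda>_. True"])
  fix c assume c: "\<And>k. k \<le> K \<Longrightarrow> k \<noteq> 0 \<Longrightarrow>
          c k = (\<Sum>k'\<le>K. redU T k k' * c k') * (\<Sum>k'\<le>K. redV T k k' * c k')"
  let ?S = "\<Sum>k\<le>K. fscale (lift T c k) (slice m n T (\<sigma> k))"
  let ?z = "1 / block_det T - (\<Sum>k\<le>K. red T 0 0 k * c k)"
  obtain a b where ab: "?S + fscale ?z (corner m n) = outer m n a b"
    using lift_rank_one[OF assms(1) c] by blast
  have "corner m n \<in> ?R"
    by (auto simp: outers_def corner_def intro!: funvec.span_base)
  moreover have "?S + fscale ?z (corner m n) \<in> ?R"
  proof
    show "?S + fscale ?z (corner m n) \<in> outers m n" using ab by (auto simp: outers_def)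
    show "?S + fscale ?z (corner m n) \<in> funvec.span (insert (corner m n) (slice m n T ` {..<l}))"
      using assms(4) by (intro funvec.span_add funvec.span_sum funvec.span_scale funvec.span_base) auto
  qed
  ultimately have "(?S + fscale ?z (corner m n)) - fscale ?z (corner m n) \<in> funvec.span ?R"
    by (intro funvec.span_diff funvec.span_scale funvec.span_base)
  then show "?S \<in> funvec.span ?R" by simp
next
  fix v :: "nat \<Rightarrow> real"
  assume "\<And>c. (\<And>k. k \<le> K \<Longrightarrow> k \<noteq> 0 \<Longrightarrow>
          c k = (\<Sum>k'\<le>K. redU T k k' * c k') * (\<Sum>k'\<le>K. redV T k k' * c k')) \<Longrightarrow> True \<Longrightarrow>
        (\<Sum>k\<le>K. v k * c k) = 0"
  then show "\<forall>k\<le>K. v k = 0"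
    using jetdet_independent[OF assms(2), of v] by blast
qed (use assms in auto)

text \<open>The level equation says that the corner coefficient in \<open>lift_rank_one\<close> is
  0, so the combination of slices is already an outer product.\<close>

lemma slices_in_span_outers_near:
  assumes "block_det T \<noteq> 0" "k \<le> K" "\<And>k. k \<le> K \<Longrightarrow> \<sigma> k < l"
    and indep: "\<And>v. (\<And>c. (\<And>k. k \<le> K \<Longrightarrow> k \<noteq> 0 \<Longrightarrow>
          c k = (\<Sum>k'\<le>K. redU T k k' * c k') * (\<Sum>k'\<le>K. redV T k k' * c k')) \<Longrightarrow>
        (\<Sum>k\<le>K. block_det T * red T 0 0 k * c k) = 1 \<Longrightarrow> (\<Sum>k\<le>K. v k * c k) = 0) \<Longrightarrow> \<forall>k\<le>K. v k = 0"
  shows "slice m n T (\<sigma> k) \<in> funvec.span (outers m n \<inter> funvec.span (slice m n T ` {..<l}))"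
    (is "_ \<in> funvec.span ?R")
proof (rule slices_in_span[where P="\<lambda>c. (\<Sum>k\<le>K. block_det T * red T 0 0 k * c k) = 1"])
  fix c assume c: "\<And>k. k \<le> K \<Longrightarrow> k \<noteq> 0 \<Longrightarrow>
          c k = (\<Sum>k'\<le>K. redU T k k' * c k') * (\<Sum>k'\<le>K. redV T k k' * c k')"
    and 1: "(\<Sum>k\<le>K. block_det T * red T 0 0 k * c k) = 1"
  let ?S = "\<Sum>k\<le>K. fscale (lift T c k) (slice m n T (\<sigma> k))"
  have "block_det T * (\<Sum>k\<le>K. red T 0 0 k * c k) = 1" using 1 by (simp add: sum_distrib_left mult.assoc)
  then have z: "1 / block_det T - (\<Sum>k\<le>K. red T 0 0 k * c k) = 0" using assms(1) by (simp add: field_simps)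
  obtain a b where "?S + fscale (1 / block_det T - (\<Sum>k\<le>K. red T 0 0 k * c k)) (corner m n) = outer m n a b"
    using lift_rank_one[OF assms(1) c] by blast
  then have "?S = outer m n a b" unfolding z by (simp add: fscale_def zero_fun_def[symmetric])
  then have "?S \<in> outers m n" by (auto simp: outers_def)
  moreover have "?S \<in> funvec.span (slice m n T ` {..<l})"
    using assms(3) by (intro funvec.span_sum funvec.span_scale funvec.span_base) auto
  ultimately show "?S \<in> funvec.span ?R" by (intro funvec.span_base) auto
next
  fix v :: "nat \<Rightarrow> real"
  assume "\<And>c. (\<And>k. k \<le> K \<Longrightarrow> k \<noteq> 0 \<Longrightarrow>
          c k = (\<Sum>k'\<le>K. redU T k k' * c k') * (\<Sum>k'\<le>K. redV T k k' * c k')) \<Longrightarrow>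
        (\<Sum>k\<le>K. block_det T * red T 0 0 k * c k) = 1 \<Longrightarrow> (\<Sum>k\<le>K. v k * c k) = 0"
  then show "\<forall>k\<le>K. v k = 0" by (rule indep)
qed (use assms in auto)

lemma polyfun_block:
  assumes "\<And>k. k \<le> K \<Longrightarrow> \<sigma> k < l" "k \<le> K" "k' \<le> K"
  shows "(\<lambda>T. block T k k') \<in> polyfun (tensor_index m n l)"
  using assms brow_bcol_bounds[OF assms(2)]
  by (cases "k = 0"; cases "k' = 0")
    (auto simp: block_def tensor_index_def intro!: polyfun.const polyfun.coord)

lemma polyfun_block_det:
  assumes "\<And>k. k \<le> K \<Longrightarrow> \<sigma> k < l"
  shows "block_det \<in> polyfun (tensor_index m n l)"
  using polyfun_ndet[of "Suc K" block "tensor_index m n l"] polyfun_block[OF assms]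
  by (simp add: block_det_def[abs_def])

lemma polyfun_red:
  assumes "\<And>k. k \<le> K \<Longrightarrow> \<sigma> k < l" "i < m" "j < n" "k \<le> K"
  shows "(\<lambda>T. red T i j k) \<in> polyfun (tensor_index m n l)"
  unfolding red_def
  by (intro polyfun_sum polyfun.mult polyfun_adj polyfun_block polyfun.coord)
    (use assms in \<open>auto simp: tensor_index_def\<close>)

lemma polyfun_jetdet:
  assumes "\<And>k. k \<le> K \<Longrightarrow> \<sigma> k < l"
  shows "(\<lambda>T. jetdet K (redU T) (redV T)) \<in> polyfun (tensor_index m n l)"
  unfolding jetdet_def
  by (intro polyfun_ndet polyfun_coeff_picard polyfun_red) (use assms brow_bcol_bounds m n in auto)

end

text \<open>Up to the entry \<open>(0, 0)\<close>, the combination of the slices with coefficients \<open>s ^ (k + 1)\<close> is the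
  rank-one matrix with entries \<open>s ^ i * s ^ b j\<close>, where \<open>b 0 = 0\<close> and \<open>b j = 1 + (j - 1) * (m - 1)\<close>.
  All slices beyond \<open>K\<close> repeat slice \<open>0\<close>.\<close>

definition base_tensor :: "nat \<Rightarrow> nat \<Rightarrow> (nat \<Rightarrow> real) \<Rightarrow> nat \<times> nat \<times> nat \<Rightarrow> real" where
  "base_tensor m K \<tau> = (\<lambda>(i, j, k). let k' = if k \<le> K then k else 0 in
    if i = 0 \<and> j = 0 then \<tau> k'
    else if k' + 1 = i + (if j = 0 then 0 else 1 + (j - 1) * (m - 1)) then 1 else 0)"

context subtensor
begin

context
  fixes \<tau> :: "nat \<Rightarrow> real" and q :: nat
  assumes q: "q = 0 \<or> K < q" and \<sigma>: "\<sigma> = (\<lambda>k. if k = 0 then q else k)"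
begin

text \<open>As the slices beyond \<open>K\<close> repeat slice 0, every choice of \<open>q\<close>
  sees the same subtensor, and one base tensor serves all of them.\<close>

lemma base_tensor_\<sigma>:
  assumes "k \<le> K"
  shows "base_tensor m K \<tau> (i, j, \<sigma> k) = (if i = 0 \<and> j = 0 then \<tau> k
    else if k + 1 = i + (if j = 0 then 0 else 1 + (j - 1) * (m - 1)) then 1 else 0)"
proof -
  have "(if \<sigma> k \<le> K then \<sigma> k else 0) = k" using assms q by (auto simp: \<sigma>)
  then show ?thesis by (simp only: base_tensor_def prod.case Let_def)
qed

lemma block_base:
  assumes "k \<le> K" "k' \<le> K"
  shows "block (base_tensor m K \<tau>) k k' = (if k = k' then 1 else 0)"
proof (cases "k = 0")
  case False
  have "brow m k + (1 + (bcol m k - 1) * (m - 1)) = (k - 1) div (m - 1) * (m - 1) + (k - 1) mod (m - 1) + 2"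
    by (simp add: brow_def bcol_def)
  also have "\<dots> = (k - 1) + 2" by (simp only: div_mult_mod_eq)
  also have "\<dots> = k + 1" using False by simp
  finally show ?thesis
    using False brow_bcol_bounds[OF assms(1)] by (auto simp: block_def base_tensor_\<sigma>[OF assms(2)])
qed (auto simp: block_def)

lemma block_det_base: "block_det (base_tensor m K \<tau>) = 1"
  unfolding block_det_def by (rule ndet_id) (auto simp: block_base)

lemma red_base:
  assumes "k \<le> K"
  shows "red (base_tensor m K \<tau>) i j k = base_tensor m K \<tau> (i, j, \<sigma> k)"
proof -
  have "adj (Suc K) (block (base_tensor m K \<tau>)) k' k = (if k' = k then 1 else 0)" if "k' \<le> K" for k'
  proof -
    have "(\<Sum>k''\<le>K. block (base_tensor m K \<tau>) k' k'' * adj (Suc K) (block (base_tensor m K \<tau>)) k'' k)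
        = adj (Suc K) (block (base_tensor m K \<tau>)) k' k"
      using that by (simp add: block_base if_distrib[of "\<lambda>x. x * _"] cong: if_cong)
    then show ?thesis
      using ndet_adj(1)[of k' "Suc K" k "block (base_tensor m K \<tau>)"] that assms block_det_base
      by (simp add: lessThan_Suc_atMost block_det_def)
  qed
  then have "red (base_tensor m K \<tau>) i j k = (\<Sum>k'\<le>K. if k' = k then base_tensor m K \<tau> (i, j, \<sigma> k') else 0)"
    unfolding red_def by (intro sum.cong) auto
  then show ?thesis using assms by simp
qed

lemma redU_base: "k' \<le> K \<Longrightarrow> redU (base_tensor m K \<tau>) k k' = monU (m - 1) k k'"
  by (auto simp: red_base base_tensor_\<sigma> monU_def brow_def)

lemma redV_base: "k' \<le> K \<Longrightarrow> redV (base_tensor m K \<tau>) k k' = monV (m - 1) k k'"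
  by (auto simp: red_base base_tensor_\<sigma> monV_def bcol_def)

lemma red00_base: "k \<le> K \<Longrightarrow> red (base_tensor m K \<tau>) 0 0 k = \<tau> k"
  by (auto simp: red_base base_tensor_\<sigma>)

end

end

section \<open>Typical ranks\<close>

context
  fixes m n l K :: nat
  assumes m: "2 \<le> m" and n: "2 \<le> n" and K: "K = (m - 1) * (n - 1)" and l: "K + 1 \<le> l"
begin

lemma AE_slices_in_span:
  assumes "q = 0 \<or> K < q" "q < l"
  shows "AE T in gaussian_tensor m n l. \<forall>k\<le>K. slice m n T (if k = 0 then q else k) \<in>
    funvec.span (outers m n \<inter> funvec.span (insert (corner m n) (slice m n T ` {..<l})))"
proof -
  define \<sigma> where "\<sigma> = (\<lambda>k. if k = 0 then q else k)"
  interpret subtensor m n K \<sigma> by unfold_locales (use m n K in auto)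
  have \<sigma>l: "\<sigma> k < l" if "k \<le> K" for k using that l assms by (auto simp: \<sigma>_def)
  let ?B = "base_tensor m K (\<lambda>_. 0)"
  have "jetdet K (redU ?B) (redV ?B) = jetdet K (monU (m - 1)) (monV (m - 1))"
    by (intro jetdet_cong) (simp_all add: redU_base[OF assms(1) \<sigma>_def] redV_base[OF assms(1) \<sigma>_def])
  then have "block_det ?B * jetdet K (redU ?B) (redV ?B) \<noteq> 0"
    by (simp add: jetdet_mon block_det_base[OF assms(1) \<sigma>_def])
  then have "AE T in gaussian_tensor m n l. block_det T * jetdet K (redU T) (redV T) \<noteq> 0"
    unfolding gaussian_tensor_def
    by (intro AE_polyfun_nonzero[where f="\<lambda>T. block_det T * jetdet K (redU T) (redV T)"]
        finite_tensor_index polyfun.mult polyfun_block_det polyfun_jetdet \<sigma>l)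
  then show ?thesis
  proof eventually_elim
    case (elim T)
    then have "block_det T \<noteq> 0" "jetdet K (redU T) (redV T) \<noteq> 0" by auto
    from slices_in_span_outers[OF this _ \<sigma>l] show ?case by (simp only: \<sigma>_def) blast
  qed
qed

text \<open>\<open>q = 0\<close> covers the slices up to \<open>K\<close>, and each later slice
  \<open>q\<close> occurs in slot 0 of its own subtensor.\<close>

lemma all_slices:
  assumes "\<And>q k. q = 0 \<or> K < q \<Longrightarrow> q < l \<Longrightarrow> k \<le> K \<Longrightarrow> slice m n T (if k = 0 then q else k) \<in> X"
    and "k < l"
  shows "slice m n T k \<in> X"
proof (cases "k \<le> K")
  case True
  then show ?thesis using assms(1)[of 0 k] l by (cases "k = 0") auto
next
  case False
  then show ?thesis using assms(1)[of k 0] assms(2) by auto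
qed

text \<open>The finitely many exceptional null sets are united; the \<open>l\<close> slices and the
  common corner then bound the dimension by \<open>l + 1\<close>.\<close>

lemma AE_tensor_rank_le: "AE T in gaussian_tensor m n l. tensor_rank m n l T \<le> l + 1"
proof -
  have "AE T in gaussian_tensor m n l. \<forall>q\<in>{q. (q = 0 \<or> K < q) \<and> q < l}. \<forall>k\<le>K. slice m n T (if k = 0 then q else k) \<in>
    funvec.span (outers m n \<inter> funvec.span (insert (corner m n) (slice m n T ` {..<l})))"
    by (intro AE_finite_allI AE_slices_in_span) auto
  then show ?thesis
  proof eventually_elim
    case (elim T)
    let ?Q = "insert (corner m n) (slice m n T ` {..<l})"
    let ?R = "outers m n \<inter> funvec.span ?Q"
    have "tensor_rank m n l T \<le> card ?Q"
    proof (rule tensor_rank_le_card)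
      show "slice m n T k \<in> funvec.span ?R" if "k < l" for k
      proof (rule all_slices[OF _ that])
        fix q k assume "q = 0 \<or> K < q" "q < l" "k \<le> K"
        then show "slice m n T (if k = 0 then q else k) \<in> funvec.span ?R"
          using elim[rule_format, of q k] by (simp only: mem_Collect_eq simp_thms)
      qed
    qed auto
    also have "\<dots> \<le> Suc (card (slice m n T ` {..<l}))" by (rule card_insert_le_m1) simp_all
    also have "\<dots> \<le> l + 1" using card_image_le[of "{..<l}" "slice m n T"] by simp
    finally show ?case .
  qed
qed

lemma rank_le_near_base:
  "\<exists>T0. \<exists>d>0. \<forall>T. (\<forall>x\<in>tensor_index m n l. \<bar>T x - T0 x\<bar> < d) \<longrightarrow> tensor_rank m n l T \<le> l"
proof -
  obtain \<tau> \<eta> where \<eta>: "0 < \<eta>" and near: "\<And>U V \<tau>' v.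
    \<forall>k\<le>K. \<forall>k'\<le>K. \<bar>U k k' - monU (m - 1) k k'\<bar> \<le> \<eta> \<and> \<bar>V k k' - monV (m - 1) k k'\<bar> \<le> \<eta> \<Longrightarrow>
    \<forall>k\<le>K. \<bar>\<tau>' k - \<tau> k\<bar> \<le> \<eta> \<Longrightarrow>
    \<forall>c. (\<forall>k\<le>K. k \<noteq> 0 \<longrightarrow> c k = (\<Sum>k'\<le>K. U k k' * c k') * (\<Sum>k'\<le>K. V k k' * c k')) \<longrightarrow>
      (\<Sum>k\<le>K. \<tau>' k * c k) = 1 \<longrightarrow> (\<Sum>k\<le>K. v k * c k) = 0 \<Longrightarrow>
    \<forall>k\<le>K. v k = (0::real)"
    using near_mon_independent[of K "m - 1"] by blast
  let ?I = "tensor_index m n l"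
  let ?B = "base_tensor m K \<tau>"
  let ?R = "\<lambda>T. outers m n \<inter> funvec.span (slice m n T ` {..<l})"
  have "\<exists>d>0. \<forall>T. (\<forall>x\<in>?I. \<bar>T x - ?B x\<bar> < d) \<longrightarrow>
      (\<forall>k\<le>K. slice m n T (if k = 0 then q else k) \<in> funvec.span (?R T))" if q: "q = 0 \<or> K < q" "q < l" for q
  proof -
    define \<sigma> where "\<sigma> = (\<lambda>k. if k = 0 then q else k)"
    interpret subtensor m n K \<sigma> by unfold_locales (use m n K in auto)
    have \<sigma>l: "\<sigma> k < l" if "k \<le> K" for k using that l q by (auto simp: \<sigma>_def)
    note base = redU_base[OF q(1) \<sigma>_def, of _ \<tau>] redV_base[OF q(1) \<sigma>_def, of _ \<tau>]
      red00_base[OF q(1) \<sigma>_def, of _ \<tau>] block_det_base[OF q(1) \<sigma>_def, of \<tau>]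
    \<comment> \<open>These polynomials carry the hypotheses of \<open>near\<close>;
      \<open>block_det T * red T 0 0 k\<close> is the perturbed level coefficient. A tolerance of at
      most 1 keeps \<open>block_det T\<close> away from 0, as its base value is 1.\<close>
    define F where "F = insert block_det ((\<lambda>(i, j, k) T. red T i j k) ` ({..<m} \<times> {..<n} \<times> {..K})
      \<union> (\<lambda>k T. block_det T * red T 0 0 k) ` {..K})"
    have "finite F" by (simp add: F_def)
    have "F \<subseteq> polyfun ?I"
      using m n by (auto simp: F_def intro!: polyfun_block_det polyfun_red polyfun.mult \<sigma>l)
    moreover have "0 < min \<eta> 1" using \<eta> by simp
    ultimately obtain d where d: "d > 0"
      "\<And>T f. \<forall>x\<in>?I. \<bar>T x - ?B x\<bar> < d \<Longrightarrow> f \<in> F \<Longrightarrow> \<bar>f T - f ?B\<bar> < min \<eta> 1"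
      using polyfun_continuous_finite[OF \<open>finite F\<close>, of ?I "min \<eta> 1" ?B] by blast
    have "slice m n T (\<sigma> k) \<in> funvec.span (?R T)" if T: "\<forall>x\<in>?I. \<bar>T x - ?B x\<bar> < d" and k: "k \<le> K" for T k
    proof (rule slices_in_span_outers_near)
      have red: "\<bar>red T i j k' - red ?B i j k'\<bar> < \<eta>" if "i < m" "j < n" "k' \<le> K" for i j k'
        using d(2)[OF T, of "\<lambda>T. red T i j k'"] that by (force simp: F_def)
      have red0: "\<bar>block_det T * red T 0 0 k' - \<tau> k'\<bar> < \<eta>" if "k' \<le> K" for k'
        using d(2)[OF T, of "\<lambda>T. block_det T * red T 0 0 k'"] that by (force simp: F_def base)
      have "\<bar>block_det T - 1\<bar> < 1" using d(2)[OF T, of block_det] by (simp add: F_def base)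
      then show "block_det T \<noteq> 0" by auto
      fix v :: "nat \<Rightarrow> real"
      assume v: "\<And>c. (\<And>k. k \<le> K \<Longrightarrow> k \<noteq> 0 \<Longrightarrow>
          c k = (\<Sum>k'\<le>K. redU T k k' * c k') * (\<Sum>k'\<le>K. redV T k k' * c k')) \<Longrightarrow>
        (\<Sum>k\<le>K. block_det T * red T 0 0 k * c k) = 1 \<Longrightarrow> (\<Sum>k\<le>K. v k * c k) = 0"
      show "\<forall>k\<le>K. v k = 0"
      proof (rule near)
        show "\<forall>k\<le>K. \<forall>k'\<le>K. \<bar>redU T k k' - monU (m - 1) k k'\<bar> \<le> \<eta> \<and> \<bar>redV T k k' - monV (m - 1) k k'\<bar> \<le> \<eta>"
        proof (intro allI impI)
          fix k k' assume "k \<le> K" "k' \<le> K"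
          then show "\<bar>redU T k k' - monU (m - 1) k k'\<bar> \<le> \<eta> \<and> \<bar>redV T k k' - monV (m - 1) k k'\<bar> \<le> \<eta>"
            using red[of "brow m k" 0 k'] red[of 0 "bcol m k" k'] brow_bcol_bounds[of k] m n by (simp add: base)
        qed
        show "\<forall>k\<le>K. \<bar>block_det T * red T 0 0 k - \<tau> k\<bar> \<le> \<eta>" using red0 by (simp add: less_imp_le)
      qed (use v in blast)
    qed (use k \<sigma>l in auto)
    then show ?thesis using d(1) unfolding \<sigma>_def by blast
  qed
  then have "\<forall>q. \<exists>d. q = 0 \<or> K < q \<longrightarrow> q < l \<longrightarrow> d > 0 \<and> (\<forall>T. (\<forall>x\<in>?I. \<bar>T x - ?B x\<bar> < d) \<longrightarrow>
      (\<forall>k\<le>K. slice m n T (if k = 0 then q else k) \<in> funvec.span (?R T)))" by blast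
  then obtain d where d: "\<And>q. q = 0 \<or> K < q \<Longrightarrow> q < l \<Longrightarrow> d q > 0"
    "\<And>q T k. q = 0 \<or> K < q \<Longrightarrow> q < l \<Longrightarrow> (\<forall>x\<in>?I. \<bar>T x - ?B x\<bar> < d q) \<Longrightarrow> k \<le> K \<Longrightarrow>
      slice m n T (if k = 0 then q else k) \<in> funvec.span (?R T)" by metis
  define A where "A = {q. (q = 0 \<or> K < q) \<and> q < l}"
  have A: "finite A" "A \<noteq> {}" using l by (auto simp: A_def intro!: exI[of _ 0])
  define d0 where "d0 = Min (d ` A)"
  have "0 < d0" unfolding d0_def using A d(1) by (subst Min_gr_iff) (auto simp: A_def)
  moreover have "tensor_rank m n l T \<le> l" if T: "\<forall>x\<in>?I. \<bar>T x - ?B x\<bar> < d0" for T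
  proof -
    have "tensor_rank m n l T \<le> card (slice m n T ` {..<l})"
    proof (rule tensor_rank_le_card)
      show "slice m n T k \<in> funvec.span (?R T)" if "k < l" for k
      proof (rule all_slices[OF _ that])
        fix q k assume q: "q = 0 \<or> K < q" "q < l" "k \<le> K"
        have "d0 \<le> d q" unfolding d0_def using A q by (intro Min_le) (auto simp: A_def)
        then have "\<forall>x\<in>?I. \<bar>T x - ?B x\<bar> < d q" using T by force
        then show "slice m n T (if k = 0 then q else k) \<in> funvec.span (?R T)" using d(2) q by blast
      qed
    qed auto
    also have "\<dots> \<le> l" using card_image_le[of "{..<l}" "slice m n T"] by simp
    finally show ?thesis .
  qed
  ultimately show ?thesis by blast
qed

end

lemma emeasure_gaussian_box_pos:
  assumes "0 < d"
  shows "0 < emeasure (gaussian_tensor m n l) (PiE (tensor_index m n l) (\<lambda>x. {T0 x - d<..<T0 x + d}))"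
proof -
  interpret G: prob_space gauss by (rule prob_space_gauss)
  interpret product_sigma_finite "\<lambda>_. gauss" by unfold_locales
  have pos: "0 < (\<Prod>i\<in>J. f i)" if "finite J" "\<And>i. i \<in> J \<Longrightarrow> 0 < f i" for J :: "(nat \<times> nat \<times> nat) set" and f :: "_ \<Rightarrow> ennreal"
    using that by (induction J) (auto simp: ennreal_zero_less_mult_iff)
  show ?thesis unfolding gaussian_tensor_def
    by (subst emeasure_PiM) (use assms in \<open>auto simp: finite_tensor_index intro!: pos emeasure_gauss_interval_pos\<close>)
qed

theorem theorem1p1:
  fixes m n l :: nat
  assumes "2 \<le> m" and "m \<le> n" and "n \<le> l"
    and "(m - 1) * (n - 1) + 1 \<le> l" and "l \<le> m * n"
  shows "(\<forall>r. typical_rank m n l r \<longrightarrow> r \<in> {l, l + 1}) \<and> typical_rank m n l l"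
proof (intro conjI allI impI)
  let ?M = "gaussian_tensor m n l"
  have n: "2 \<le> n" using assms(1,2) by linarith
  note ge = AE_tensor_rank_ge[OF assms(5)]
  note le = AE_tensor_rank_le[OF assms(1) n refl assms(4)]
  show "r \<in> {l, l + 1}" if "typical_rank m n l r" for r
  proof (rule ccontr)
    assume r: "r \<notin> {l, l + 1}"
    have "AE T in ?M. tensor_rank m n l T \<noteq> r"
      using ge le by eventually_elim (use r in auto)
    then have "emeasure ?M {T \<in> space ?M. tensor_rank m n l T = r} = 0"
      by (rule emeasure_eq_0_AE)
    then show False using that by (simp add: typical_rank_def measure_def)
  qed
  \<comment> \<open>Otherwise the rank would exceed \<open>l\<close> almost surely, although it is
    at most \<open>l\<close> on a box of positive measure.\<close>
  have "measure ?M {T \<in> space ?M. tensor_rank m n l T = l} \<noteq> 0"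
  proof
    assume "measure ?M {T \<in> space ?M. tensor_rank m n l T = l} = 0"
    interpret prob_space ?M
      unfolding gaussian_tensor_def by (intro prob_space_PiM prob_space_gauss)
    have "{T \<in> space ?M. tensor_rank m n l T = l} \<in> null_sets ?M"
      using \<open>measure ?M _ = 0\<close> measurable_tensor_rank by (intro null_setsI) (simp_all add: emeasure_eq_measure)
    then have "AE T in ?M. T \<notin> {T \<in> space ?M. tensor_rank m n l T = l}" by (rule AE_not_in)
    with ge have *: "AE T in ?M. \<not> tensor_rank m n l T \<le> l"
      using AE_space by eventually_elim auto
    obtain T0 d where d: "0 < d"
      "\<And>T. (\<forall>x\<in>tensor_index m n l. \<bar>T x - T0 x\<bar> < d) \<Longrightarrow> tensor_rank m n l T \<le> l"
      using rank_le_near_base[OF assms(1) n refl assms(4)] by blast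
    let ?B = "PiE (tensor_index m n l) (\<lambda>x. {T0 x - d<..<T0 x + d})"
    have box: "tensor_rank m n l T \<le> l" if "T \<in> ?B" for T
      by (rule d(2)) (use that in \<open>force simp: PiE_iff abs_less_iff\<close>)
    have "AE T in ?M. T \<notin> ?B" using * by eventually_elim (use box in blast)
    moreover have "?B \<in> sets ?M"
      unfolding gaussian_tensor_def by (intro sets_PiM_I_finite finite_tensor_index) auto
    ultimately have "emeasure ?M ?B = 0"
      by (simp add: AE_iff_null_sets[symmetric] null_setsD1)
    then show False using emeasure_gaussian_box_pos[OF d(1), of m n l T0] by simp
  qed
  then show "typical_rank m n l l"
    using assms(1-3) by (simp add: typical_rank_def zero_less_measure_iff)
qed

end
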